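(* For each even $n \in \mathbb{N}$ let $p = p(n) \in [0,1]$, let $\mathbb{P} = \mathbb{P}_n$ be the law of $\mathbb{G}(n,p)$ with a planted uniformly random perfect matching of $K_n$, and let $\mathbb{Q} = \mathbb{Q}_n = \mathbb{G}(n,q)$ with $q = p + \frac{1-p}{n-1}$. Then, with the limit taken along even $n$, \[ \lim_{n \to \infty} \mathrm{d}_{\mathrm{TV}}(\mathbb{P},\mathbb{Q}) = \begin{cases} 0 & \text{when } p = \omega(n^{-1/2}),\\ 1 & \text{when } p = o(n^{-1/2}). \end{cases} \]
   Context: All graphs are simple labelled graphs on the vertex set $[n]=\{1,\dots,n\}$, and $K_n$ is the complete graph on $[n]$. $\mathbb{G}(n,a)$ denotes the law of the Erdős–Rényi random graph on $[n]$, in which each of the $\binom{n}{2}$ possible edges is present independently with probability $a$. Planted distribution: $\mathbb{P}$ is the law of the simple graph whose edge set is $E(\mathbf{G}_0)\cup E(\mathbf{H})$, where $\mathbf{G}_0 \sim \mathbb{G}(n,p)$ and $\mathbf{H}$ is independent of $\mathbf{G}_0$ and uniformly distributed over all perfect matchings of $K_n$ (viewed as graphs on $[n]$ with $n/2$ edges). The value of $q$ is such that the expected numbers of edges under $\mathbb{P}$ and $\mathbb{Q}$ coincide. $\mathrm{d}_{\mathrm{TV}}(\mathbb{P},\mathbb{Q}) = \frac12\sum_G |\mathbb{P}(G)-\mathbb{Q}(G)|$ is the total variation distance, the sum being over all graphs $G$ on $[n]$. The edge probability $p$ may depend on $n$; $p = \omega(n^{-1/2})$ means $p\, n^{1/2}\to\infty$,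 and $p = o(n^{-1/2})$ means $p\, n^{1/2}\to 0$, as $n\to\infty$. *)

theory Defs
  imports "HOL-Probability.Probability"
begin

text \<open>A simple labelled graph on the vertex set \<open>{1..n}\<close> is represented by its edge set,
  a set of two-element subsets of \<open>{1..n}\<close>.\<close>

definition complete_edges :: "nat \<Rightarrow> nat set set" where
  "complete_edges n = {e. e \<subseteq> {1..n} \<and> card e = 2}"

definition graphs :: "nat \<Rightarrow> nat set set set" where
  "graphs n = Pow (complete_edges n)"

definition perfect_matchings :: "nat \<Rightarrow> nat set set set" where
  "perfect_matchings n = {M \<in> graphs n. \<forall>v \<in> {1..n}. \<exists>!e. e \<in> M \<and> v \<in> e}"

definition erdos_renyi :: "nat \<Rightarrow> real \<Rightarrow> nat set set pmf" where
  "erdos_renyi n a =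
     map_pmf (\<lambda>present. {e \<in> complete_edges n. present e})
       (Pi_pmf (complete_edges n) False (\<lambda>_. bernoulli_pmf a))"

definition planted_matching :: "nat \<Rightarrow> real \<Rightarrow> nat set set pmf" where
  "planted_matching n p =
     map_pmf (\<lambda>(G\<^sub>0, H). G\<^sub>0 \<union> H)
       (pair_pmf (erdos_renyi n p) (pmf_of_set (perfect_matchings n)))"

definition graph_tv_dist :: "nat \<Rightarrow> nat set set pmf \<Rightarrow> nat set set pmf \<Rightarrow> real" where
  "graph_tv_dist n P Q = 1 / 2 * (\<Sum>G \<in> graphs n. \<bar>pmf P G - pmf Q G\<bar>)"

text \<open>The filter for limits \<open>n \<rightarrow> \<infinity>\<close> along even \<open>n\<close>.\<close>

definition even_at_top :: "nat filter" where
  "even_at_top = inf at_top (principal {n. even n})"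

text \<open>\<^const>\<open>pmf_of_set\<close> and \<^const>\<open>bernoulli_pmf\<close> are only meaningful for finite nonempty
  sets and for parameters in \<open>[0,1]\<close>, respectively; \<^const>\<open>sum\<close> is zero over infinite sets.
  The following facts show that these side conditions hold in the definitions above.\<close>

lemma finite_complete_edges: "finite (complete_edges n)"
  unfolding complete_edges_def by (rule finite_subset[of _ "Pow {1..n}"]) auto

lemma finite_graphs: "finite (graphs n)"
  by (simp add: graphs_def finite_complete_edges)

lemma finite_perfect_matchings: "finite (perfect_matchings n)"
  by (simp add: perfect_matchings_def finite_graphs)

lemma perfect_matchings_nonempty:
  assumes "even n"
  shows "perfect_matchings n \<noteq> {}"
proof -
  from assms obtain k where n: "n = 2 * k" by (elim evenE)
  define M where "M = (\<lambda>i. {2 * i + 1, 2 * i + 2}) ` {..<k}"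
  have "M \<in> graphs n"
    by (auto simp: M_def graphs_def complete_edges_def n)
  moreover have "\<exists>!e. e \<in> M \<and> v \<in> e" if v: "v \<in> {1..n}" for v
  proof (rule ex1I)
    let ?i = "(v - 1) div 2"
    have "?i < k" using v n by auto
    moreover have "v = 2 * ?i + 1 \<or> v = 2 * ?i + 2" using v by auto
    ultimately show "{2 * ?i + 1, 2 * ?i + 2} \<in> M \<and> v \<in> {2 * ?i + 1, 2 * ?i + 2}"
      unfolding M_def by blast
    fix e assume "e \<in> M \<and> v \<in> e"
    then obtain i where e: "e = {2 * i + 1, 2 * i + 2}" and "v = 2 * i + 1 \<or> v = 2 * i + 2"
      unfolding M_def by auto
    then have "i = ?i" by auto
    then show "e = {2 * ?i + 1, 2 * ?i + 2}" using e by simp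
  qed
  ultimately have "M \<in> perfect_matchings n"
    by (simp add: perfect_matchings_def)
  then show ?thesis by blast
qed

lemma null_edge_probability_bounds:
  assumes "p \<in> {0..1}" "n \<ge> 2"
  shows "p + (1 - p) / (real n - 1) \<in> {0..1}"
proof -
  have "0 \<le> (1 - p) / (real n - 1)" using assms by simp
  moreover have "(1 - p) / (real n - 1) \<le> 1 - p"
    using assms by (auto simp: divide_le_eq mult_le_cancel_left1)
  ultimately show ?thesis using assms by auto
qed

end

theory Submission
  imports Defs
begin

text \<open>
  Given the planted matching \<open>H\<close>, the planted graph has independent edges, present with
  probability \<open>1\<close> on \<open>H\<close> and \<open>p\<close> elsewhere; thus \<open>P\<close> is a mixture of product measures.

  For \<open>p = \<omega>(n^(-1/2))\<close>, by Cauchy--Schwarz the distance is at most half the square root of the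
  chi-square divergence. Its expression as an average over two matchings \<open>H, H'\<close> is, up to an
  explicit factor, the average of \<open>x ^ card (H \<inter> H')\<close> with \<open>x\<close> close to \<open>1 / p\<close>. Although \<open>x\<close> is
  unbounded, this exponential moment is at most that of a Poisson variable of mean \<open>1/2\<close> up to a
  factor \<open>1 + O(x^2 / n)\<close>, and the leading terms of the exponents cancel.

  For \<open>p = o(n^(-1/2))\<close>, the signed count of pairs of adjacent edges, i.e. the sum of
  \<open>(G_e - q) (G_f - q)\<close>, separates the two laws. It has mean \<open>0\<close> under the null model.
  As the expected degrees of both models agree, planting shifts its mean by an amount of order
  \<open>n\<close>, independent of \<open>H\<close>, whereas both variances are \<open>O(n^3 p^2 + n) = o(n^2)\<close>.
\<close>

subsection \<open>Product measures on subsets of a finite set\<close>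

definition product_weight :: "'a set \<Rightarrow> ('a \<Rightarrow> real) \<Rightarrow> 'a set \<Rightarrow> real" where
  "product_weight E \<theta> G = (\<Prod>e\<in>E. if e \<in> G then \<theta> e else 1 - \<theta> e)"

text \<open>Expectations of edgewise products factorise: expanding the product on the right,
  \<open>G\<close> records the edges where the \<open>True\<close> summand is chosen.\<close>

lemma sum_product_weight_prod:
  assumes "finite E"
  shows "(\<Sum>G\<in>Pow E. product_weight E \<theta> G * (\<Prod>e\<in>E. \<phi> e (e \<in> G))) =
    (\<Prod>e\<in>E. \<theta> e * \<phi> e True + (1 - \<theta> e) * \<phi> e False)"
proof -
  have "product_weight E \<theta> G * (\<Prod>e\<in>E. \<phi> e (e \<in> G)) =
      (\<Prod>e\<in>G. \<theta> e * \<phi> e True) * (\<Prod>e\<in>E - G. (1 - \<theta> e) * \<phi> e False)" if "G \<subseteq> E" for G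
  proof -
    have "product_weight E \<theta> G * (\<Prod>e\<in>E. \<phi> e (e \<in> G)) =
        (\<Prod>e\<in>E. if e \<in> G then \<theta> e * \<phi> e True else (1 - \<theta> e) * \<phi> e False)"
      unfolding product_weight_def prod.distrib[symmetric] by (intro prod.cong) auto
    also have "\<dots> = (\<Prod>e\<in>E - G. (1 - \<theta> e) * \<phi> e False) * (\<Prod>e\<in>G. \<theta> e * \<phi> e True)"
      by (subst prod.subset_diff[OF that assms], intro arg_cong2[of _ _ _ _ "(*)"] prod.cong) auto
    finally show ?thesis by (simp only: mult.commute)
  qed
  then show ?thesis
    by (simp add: prod_add[OF assms])
qed

text \<open>Orthogonality: an edge in exactly one of \<open>S\<close> and \<open>T\<close>
  contributes the mean of a centred Bernoulli variable, which is zero; if \<open>S = T\<close>, each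
  edge contributes its variance.\<close>

lemma sum_product_weight_centered_monomials:
  fixes \<theta> :: "'a \<Rightarrow> real"
  assumes "finite E" "S \<subseteq> E" "T \<subseteq> E"
  defines "Y \<equiv> \<lambda>G e. of_bool (e \<in> G) - \<theta> e"
  shows "(\<Sum>G\<in>Pow E. product_weight E \<theta> G * ((\<Prod>e\<in>S. Y G e) * (\<Prod>e\<in>T. Y G e))) =
    (if S = T then \<Prod>e\<in>S. \<theta> e * (1 - \<theta> e) else 0)"
proof -
  \<comment> \<open>Padding both products with factors 1 up to \<open>E\<close> makes the integrand
    a single edgewise product.\<close>
  define \<phi> where "\<phi> e b = (if e \<in> S then of_bool b - \<theta> e else 1) * (if e \<in> T then of_bool b - \<theta> e else 1)"
    for e b
  have res: "(\<Prod>e\<in>A. f e) = (\<Prod>e\<in>E. if e \<in> A then f e else 1)" if "A \<subseteq> E" for A and f :: "'a \<Rightarrow> real"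
    using prod.inter_restrict[of E f A] assms(1) that by (simp add: Int_absorb1)
  have "(\<Prod>e\<in>S. Y G e) * (\<Prod>e\<in>T. Y G e) = (\<Prod>e\<in>E. \<phi> e (e \<in> G))" for G
    unfolding res[OF assms(2)] res[OF assms(3)] prod.distrib[symmetric] \<phi>_def Y_def by simp
  then have "(\<Sum>G\<in>Pow E. product_weight E \<theta> G * ((\<Prod>e\<in>S. Y G e) * (\<Prod>e\<in>T. Y G e))) =
      (\<Prod>e\<in>E. \<theta> e * \<phi> e True + (1 - \<theta> e) * \<phi> e False)"
    using sum_product_weight_prod[OF assms(1)] by simp
  also have "\<dots> = (if S = T then \<Prod>e\<in>S. \<theta> e * (1 - \<theta> e) else 0)"
  proof (cases "S = T")
    case True
    then show ?thesis
      unfolding \<phi>_def by (simp add: res[OF assms(3)], intro prod.cong) (auto simp: algebra_simps)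
  next
    case False
    then obtain e where "e \<in> E" "e \<in> S \<longleftrightarrow> e \<notin> T" using assms by blast
    then have "\<theta> e * \<phi> e True + (1 - \<theta> e) * \<phi> e False = 0"
      by (auto simp: \<phi>_def algebra_simps)
    with \<open>e \<in> E\<close> assms(1) False show ?thesis by (auto intro!: prod_zero)
  qed
  finally show ?thesis .
qed

text \<open>A Parseval identity, as orthogonality kills all off-diagonal pairs of monomials. It is
  the source of the variance bounds for \<open>signed_wedges\<close>.\<close>

lemma second_moment_centered_polynomial:
  fixes \<theta> :: "'a \<Rightarrow> real"
  assumes "finite E" "F \<subseteq> Pow E"
  defines "Y \<equiv> \<lambda>G e. of_bool (e \<in> G) - \<theta> e"
  shows "(\<Sum>G\<in>Pow E. product_weight E \<theta> G * (\<Sum>S\<in>F. a S * (\<Prod>e\<in>S. Y G e))\<^sup>2) =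
    (\<Sum>S\<in>F. (a S)\<^sup>2 * (\<Prod>e\<in>S. \<theta> e * (1 - \<theta> e)))"
proof -
  have finF: "finite F" using assms by (meson finite_Pow_iff finite_subset)
  have "(\<Sum>G\<in>Pow E. product_weight E \<theta> G * (\<Sum>S\<in>F. a S * (\<Prod>e\<in>S. Y G e))\<^sup>2) =
      (\<Sum>G\<in>Pow E. \<Sum>S\<in>F. \<Sum>T\<in>F. a S * a T * (product_weight E \<theta> G * ((\<Prod>e\<in>S. Y G e) * (\<Prod>e\<in>T. Y G e))))"
    by (simp add: power2_eq_square sum_distrib_left sum_distrib_right mult_ac)
  also have "\<dots> = (\<Sum>S\<in>F. \<Sum>T\<in>F. a S * a T * (\<Sum>G\<in>Pow E. product_weight E \<theta> G * ((\<Prod>e\<in>S. Y G e) * (\<Prod>e\<in>T. Y G e))))"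
    unfolding sum_distrib_left by (subst sum.swap, rule sum.cong[OF refl], rule sum.swap)
  also have "\<dots> = (\<Sum>S\<in>F. \<Sum>T\<in>F. if T = S then (a S)\<^sup>2 * (\<Prod>e\<in>S. \<theta> e * (1 - \<theta> e)) else 0)"
    unfolding Y_def using assms(2)
    by (intro sum.cong refl, subst sum_product_weight_centered_monomials[OF assms(1)])
      (auto simp: power2_eq_square)
  also have "\<dots> = (\<Sum>S\<in>F. (a S)\<^sup>2 * (\<Prod>e\<in>S. \<theta> e * (1 - \<theta> e)))"
    using finF by (intro sum.cong refl) simp
  finally show ?thesis .
qed

section \<open>The two graph laws as explicit weights\<close>

lemma pmf_random_subset:
  assumes "finite E" "G \<subseteq> E" "\<And>e. e \<in> E \<Longrightarrow> \<theta> e \<in> {0..1}"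
  shows "pmf (map_pmf (\<lambda>present. {e \<in> E. present e}) (Pi_pmf E False (\<lambda>e. bernoulli_pmf (\<theta> e)))) G =
    product_weight E \<theta> G"
proof -
  let ?M = "Pi_pmf E False (\<lambda>e. bernoulli_pmf (\<theta> e))"
  \<comment> \<open>With default value \<open>False\<close>, the sampled predicates are false
    outside \<open>E\<close>, so restricting to \<open>E\<close> changes nothing and the map becomes
    the injective \<open>Collect\<close>.\<close>
  have "map_pmf (\<lambda>present. {e \<in> E. present e}) ?M = map_pmf Collect ?M"
    using set_Pi_pmf_subset[OF assms(1), of False "\<lambda>e. bernoulli_pmf (\<theta> e)"]
    by (intro map_pmf_cong refl) blast
  moreover have "pmf (map_pmf Collect ?M) (Collect (\<lambda>e. e \<in> G)) = pmf ?M (\<lambda>e. e \<in> G)"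
    by (rule pmf_map_inj') (auto simp: inj_on_def)
  moreover have "pmf ?M (\<lambda>e. e \<in> G) = product_weight E \<theta> G"
    unfolding product_weight_def using assms
    by (subst pmf_Pi) (auto intro!: prod.cong)
  ultimately show ?thesis by simp
qed

lemma pmf_erdos_renyi:
  assumes "G \<in> graphs n" "a \<in> {0..1}"
  shows "pmf (erdos_renyi n a) G = product_weight (complete_edges n) (\<lambda>_. a) G"
  unfolding erdos_renyi_def using assms
  by (intro pmf_random_subset finite_complete_edges) (auto simp: graphs_def)

definition planted_prob :: "real \<Rightarrow> 'a set \<Rightarrow> 'a \<Rightarrow> real" where
  "planted_prob p H e = (if e \<in> H then 1 else p)"

lemma planted_prob_bounds: "p \<in> {0..1} \<Longrightarrow> planted_prob p H e \<in> {0..1}"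
  by (simp add: planted_prob_def)

text \<open>Adding \<open>H\<close> acts on each edge separately, as a disjunction with the constant
  \<open>e \<in> H\<close>; edges stay independent and only their probabilities change.\<close>

lemma map_erdos_renyi_Un:
  assumes "H \<in> graphs n" "p \<in> {0..1}"
  shows "map_pmf (\<lambda>G. G \<union> H) (erdos_renyi n p) =
    map_pmf (\<lambda>present. {e \<in> complete_edges n. present e})
      (Pi_pmf (complete_edges n) False (\<lambda>e. bernoulli_pmf (planted_prob p H e)))"
proof -
  let ?E = "complete_edges n"
  have bern: "bernoulli_pmf (planted_prob p H e) =
      bernoulli_pmf p \<bind> (\<lambda>b. return_pmf (b \<or> e \<in> H))" for e
  proof (cases "e \<in> H")
    case True
    moreover have "bernoulli_pmf 1 = return_pmf True"
      by (intro pmf_eqI) (simp add: indicator_def split: bool.split)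
    ultimately show ?thesis by (simp add: planted_prob_def bind_pmf_const)
  qed (simp add: planted_prob_def bind_return_pmf')
  have "Pi_pmf ?E False (\<lambda>e. bernoulli_pmf (planted_prob p H e)) =
      map_pmf (\<lambda>f x. if x \<in> ?E then f x \<or> x \<in> H else False) (Pi_pmf ?E False (\<lambda>_. bernoulli_pmf p))"
    unfolding bern
    by (subst Pi_pmf_bind[OF finite_complete_edges, where d' = False])
      (simp add: finite_complete_edges map_pmf_def)
  then show ?thesis
    unfolding erdos_renyi_def map_pmf_comp o_def
    using assms(1) by (auto simp: graphs_def map_pmf_comp intro!: map_pmf_cong)
qed

lemma pmf_planted_matching:
  assumes "even n" "G \<in> graphs n" "p \<in> {0..1}"
  shows "pmf (planted_matching n p) G =
    (\<Sum>H\<in>perfect_matchings n. product_weight (complete_edges n) (planted_prob p H) G)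
      / card (perfect_matchings n)"
proof -
  have "planted_matching n p =
      pmf_of_set (perfect_matchings n) \<bind> (\<lambda>H. map_pmf (\<lambda>G. G \<union> H) (erdos_renyi n p))"
    unfolding planted_matching_def pair_pmf_def map_bind_pmf
    by (subst bind_commute_pmf) (simp add: map_pmf_def bind_assoc_pmf bind_return_pmf)
  moreover have "pmf (map_pmf (\<lambda>G. G \<union> H) (erdos_renyi n p)) G =
      product_weight (complete_edges n) (planted_prob p H) G" if "H \<in> perfect_matchings n" for H
    using that assms planted_prob_bounds[OF assms(3), of H]
    by (subst map_erdos_renyi_Un)
      (auto simp: perfect_matchings_def graphs_def
         intro!: pmf_random_subset finite_complete_edges)
  ultimately show ?thesis
    by (simp add: pmf_bind_pmf_of_set finite_perfect_matchings perfect_matchings_nonempty[OF assms(1)])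
qed

lemma sum_pmf_erdos_renyi: "(\<Sum>G\<in>graphs n. pmf (erdos_renyi n a) G) = 1"
  by (rule sum_pmf_eq_1[OF finite_graphs]) (auto simp: erdos_renyi_def graphs_def)

lemma sum_pmf_planted_matching:
  assumes "even n"
  shows "(\<Sum>G\<in>graphs n. pmf (planted_matching n p) G) = 1"
proof (rule sum_pmf_eq_1[OF finite_graphs])
  have "set_pmf (erdos_renyi n p) \<subseteq> graphs n"
    by (auto simp: erdos_renyi_def graphs_def)
  moreover have "perfect_matchings n \<subseteq> graphs n"
    by (auto simp: perfect_matchings_def)
  ultimately show "set_pmf (planted_matching n p) \<subseteq> graphs n"
    using perfect_matchings_nonempty[OF assms] finite_perfect_matchings[of n]
    by (auto simp: planted_matching_def graphs_def)
qed

lemma tv_dist_le_1: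
  assumes "even n"
  shows "graph_tv_dist n (planted_matching n p) (erdos_renyi n q) \<le> 1"
proof -
  have "(\<Sum>G\<in>graphs n. \<bar>pmf (planted_matching n p) G - pmf (erdos_renyi n q) G\<bar>)
      \<le> (\<Sum>G\<in>graphs n. pmf (planted_matching n p) G + pmf (erdos_renyi n q) G)"
    by (intro sum_mono) (simp add: abs_diff_le_iff abs_le_iff)
  also have "\<dots> = 2"
    by (simp add: sum.distrib sum_pmf_erdos_renyi sum_pmf_planted_matching[OF assms])
  finally show ?thesis by (simp add: graph_tv_dist_def)
qed

subsection \<open>Counting perfect matchings\<close>

text \<open>An arbitrary vertex set replaces \<open>{1..n}\<close> because the counting inductions
  delete the endpoints of an edge.\<close>

definition matchings_on :: "'a set \<Rightarrow> 'a set set set" where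
  "matchings_on V = {M. M \<subseteq> {e. e \<subseteq> V \<and> card e = 2} \<and> (\<forall>v\<in>V. \<exists>!e. e \<in> M \<and> v \<in> e)}"

lemma perfect_matchings_eq: "perfect_matchings n = matchings_on {1..n}"
  unfolding perfect_matchings_def matchings_on_def graphs_def complete_edges_def Pow_iff ..

lemma finite_matchings_on: "finite V \<Longrightarrow> finite (matchings_on V)"
  by (rule finite_subset[of _ "Pow (Pow V)"]) (auto simp: matchings_on_def)

lemma matchings_onI:
  assumes "\<And>e. e \<in> M \<Longrightarrow> e \<subseteq> V \<and> card e = 2" "\<And>v. v \<in> V \<Longrightarrow> \<exists>!e. e \<in> M \<and> v \<in> e"
  shows "M \<in> matchings_on V"
  using assms by (simp add: matchings_on_def subset_iff)

lemma matchings_on_edge: "M \<in> matchings_on V \<Longrightarrow> e \<in> M \<Longrightarrow> e \<subseteq> V \<and> card e = 2"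
  by (simp add: matchings_on_def subset_iff)

lemma matchings_on_covers: "M \<in> matchings_on V \<Longrightarrow> v \<in> V \<Longrightarrow> \<exists>!e. e \<in> M \<and> v \<in> e"
  by (simp add: matchings_on_def)

lemma matchings_on_disjoint:
  assumes "M \<in> matchings_on V" "e \<in> M" "f \<in> M" "v \<in> e" "v \<in> f"
  shows "e = f"
proof -
  have "v \<in> V" using assms matchings_on_edge by blast
  then show ?thesis using matchings_on_covers[OF assms(1)] assms by blast
qed

lemma matchings_on_remove:
  assumes M: "M \<in> matchings_on V" and e: "e \<in> M"
  shows "M - {e} \<in> matchings_on (V - e)"
proof (rule matchings_onI)
  fix f assume "f \<in> M - {e}"
  then show "f \<subseteq> V - e \<and> card f = 2"
    using matchings_on_disjoint[OF M e, of f] matchings_on_edge[OF M, of f] by blast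
next
  fix v assume v: "v \<in> V - e"
  then have "f \<in> M - {e} \<and> v \<in> f \<longleftrightarrow> f \<in> M \<and> v \<in> f" for f by blast
  then show "\<exists>!f. f \<in> M - {e} \<and> v \<in> f"
    using matchings_on_covers[OF M] v by simp
qed

lemma matchings_on_insert:
  assumes M: "M \<in> matchings_on (V - e)" and e: "e \<subseteq> V" "card e = 2"
  shows "insert e M \<in> matchings_on V" "e \<notin> M"
proof -
  have "e \<noteq> {}" using e by auto
  then show "e \<notin> M" using matchings_on_edge[OF M] by blast
  show "insert e M \<in> matchings_on V"
  proof (rule matchings_onI)
    fix f assume "f \<in> insert e M"
    then show "f \<subseteq> V \<and> card f = 2" using matchings_on_edge[OF M] e by blast
  next
    fix v assume v: "v \<in> V"
    show "\<exists>!f. f \<in> insert e M \<and> v \<in> f"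
    proof (cases "v \<in> e")
      case True
      then have "f \<in> insert e M \<and> v \<in> f \<longleftrightarrow> f = e" for f
        using matchings_on_edge[OF M, of f] by blast
      then show ?thesis by simp
    next
      case False
      then have "f \<in> insert e M \<and> v \<in> f \<longleftrightarrow> f \<in> M \<and> v \<in> f" for f by blast
      then show ?thesis using matchings_on_covers[OF M] v False by simp
    qed
  qed
qed

text \<open>Deleting \<open>e\<close> together with its endpoints is a bijection, inverted by
  inserting \<open>e\<close>. As \<open>e \<notin> S\<close>, the deletion does not disturb
  \<open>S\<close>.\<close>

lemma card_matchings_containing_insert:
  assumes "e \<subseteq> V" "card e = 2" "e \<notin> S"
  shows "card {M \<in> matchings_on V. insert e S \<subseteq> M} = card {M \<in> matchings_on (V - e). S \<subseteq> M}"
proof (rule sym, rule bij_betw_same_card)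
  show "bij_betw (insert e) {M \<in> matchings_on (V - e). S \<subseteq> M} {M \<in> matchings_on V. insert e S \<subseteq> M}"
  proof (rule bij_betw_byWitness[where f' = "\<lambda>M. M - {e}"])
    show "\<forall>M\<in>{M \<in> matchings_on (V - e). S \<subseteq> M}. insert e M - {e} = M"
      using matchings_on_insert(2)[OF _ assms(1,2)] by auto
    show "insert e ` {M \<in> matchings_on (V - e). S \<subseteq> M} \<subseteq> {M \<in> matchings_on V. insert e S \<subseteq> M}"
      using matchings_on_insert(1)[OF _ assms(1,2)] by auto
    show "(\<lambda>M. M - {e}) ` {M \<in> matchings_on V. insert e S \<subseteq> M} \<subseteq> {M \<in> matchings_on (V - e). S \<subseteq> M}"
      using matchings_on_remove[of _ V e] assms(3) by auto
  qed auto
qed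

text \<open>The double factorial \<open>(2 h - 1)!!\<close>, with value 1 at
  \<open>h = 0\<close>.\<close>

primrec matching_number :: "nat \<Rightarrow> nat" where
  "matching_number 0 = 1"
| "matching_number (Suc h) = (2 * h + 1) * matching_number h"

lemma matching_number_pos: "matching_number h > 0"
  by (induction h) auto

text \<open>Matchings are classified by the partner of a fixed vertex \<open>v\<close>: in the
  inductive step there are \<open>2 h + 1\<close> choices, each leaving \<open>2 h\<close>
  vertices.\<close>

lemma card_matchings_on:
  assumes "finite V" "card V = 2 * h"
  shows "card (matchings_on V) = matching_number h"
  using assms
proof (induction h arbitrary: V)
  case 0
  then have "V = {}" by simp
  then have "matchings_on V = {{}}"
    by (auto simp: matchings_on_def)
  then show ?case by simp
next
  case (Suc h)
  then obtain v where v: "v \<in> V" by fastforce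
  have edge: "{v, w} \<subseteq> V \<and> card {v, w} = 2" if "w \<in> V - {v}" for w
    using that v by auto
  have "\<exists>w\<in>V - {v}. {v, w} \<in> M" if M: "M \<in> matchings_on V" for M
  proof -
    obtain e where e: "e \<in> M" "v \<in> e" "e \<subseteq> V" "card e = 2"
      using matchings_on_covers[OF M v] matchings_on_edge[OF M] by blast
    then obtain w where "w \<noteq> v" "e = {v, w}" by (metis card_2_iff' card_2_iff insertE singletonD insert_commute)
    with e show ?thesis by blast
  qed
  then have "matchings_on V = (\<Union>w\<in>V - {v}. {M \<in> matchings_on V. {{v, w}} \<subseteq> M})"
    by auto
  also have "card \<dots> = (\<Sum>w\<in>V - {v}. card {M \<in> matchings_on V. {{v, w}} \<subseteq> M})"
  proof (rule card_UN_disjoint)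
    show "\<forall>w\<in>V - {v}. \<forall>w'\<in>V - {v}. w \<noteq> w' \<longrightarrow>
        {M \<in> matchings_on V. {{v, w}} \<subseteq> M} \<inter> {M \<in> matchings_on V. {{v, w'}} \<subseteq> M} = {}"
    proof (intro ballI impI)
      fix w w' assume "w \<in> V - {v}" "w' \<in> V - {v}" "w \<noteq> w'"
      then have "{v, w} \<noteq> {v, w'}" by (auto simp: doubleton_eq_iff)
      then show "{M \<in> matchings_on V. {{v, w}} \<subseteq> M} \<inter> {M \<in> matchings_on V. {{v, w'}} \<subseteq> M} = {}"
        using matchings_on_disjoint[of _ V "{v, w}" "{v, w'}" v] by auto
    qed
  qed (use Suc.prems finite_matchings_on[of V] in auto)
  also have "\<dots> = (\<Sum>w\<in>V - {v}. matching_number h)"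
  proof (rule sum.cong[OF refl])
    fix w assume w: "w \<in> V - {v}"
    have "card (V - {v, w}) = 2 * h"
      using edge[OF w] Suc.prems by (subst card_Diff_subset) auto
    then show "card {M \<in> matchings_on V. {{v, w}} \<subseteq> M} = matching_number h"
      using card_matchings_containing_insert[of "{v, w}" V "{}"] edge[OF w] Suc by simp
  qed
  also have "\<dots> = matching_number (Suc h)"
    using Suc.prems v by simp
  finally show ?case .
qed

lemma card_matching:
  assumes "finite V" "card V = 2 * h" "M \<in> matchings_on V"
  shows "card M = h"
proof -
  have "V = \<Union>M"
    using matchings_on_covers[OF assms(3)] matchings_on_edge[OF assms(3)] by blast
  moreover have "card (\<Union>M) = (\<Sum>e\<in>M. card e)"
  proof (rule card_Union_disjoint)
    show "pairwise disjnt M"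
      using matchings_on_disjoint[OF assms(3)] by (auto simp: pairwise_def disjnt_def)
    show "finite e" if "e \<in> M" for e
      using that assms by (auto simp: matchings_on_def intro: finite_subset)
  qed
  moreover have "(\<Sum>e\<in>M. card e) = (\<Sum>e\<in>M. 2)"
    using assms(3) by (intro sum.cong) (auto simp: matchings_on_def)
  ultimately show ?thesis using assms(2) by simp
qed

text \<open>The edges of \<open>S\<close> are removed one at a time. The matching \<open>M\<close>
  certifies that they are disjoint, and loses the same edge in each step so that it certifies the
  rest.\<close>

lemma card_matchings_containing:
  assumes "finite V" "card V = 2 * h" "M \<in> matchings_on V" "S \<subseteq> M"
  shows "card {M' \<in> matchings_on V. S \<subseteq> M'} = matching_number (h - card S)"
proof -
  have "finite M" using assms by (auto simp: matchings_on_def intro: finite_subset[of _ "Pow V"])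
  then have "finite S" using assms(4) finite_subset by blast
  then show ?thesis using assms
  proof (induction S arbitrary: V h M rule: finite_induct)
    case empty
    then show ?case by (simp add: card_matchings_on)
  next
    case (insert e S)
    have e: "e \<subseteq> V" "card e = 2" "e \<in> M" using insert.prems by (auto simp: matchings_on_def)
    have cV: "card (V - e) = 2 * (h - 1)"
      using insert.prems e by (subst card_Diff_subset) (auto intro: finite_subset)
    have "card {M' \<in> matchings_on (V - e). S \<subseteq> M'} = matching_number (h - 1 - card S)"
      using insert.hyps insert.prems matchings_on_remove[OF insert.prems(3) e(3)]
      by (intro insert.IH[OF _ cV]) auto
    then show ?case
      using card_matchings_containing_insert[OF e(1,2) insert.hyps(2)] insert.hyps by simp
  qed
qed

section \<open>The overlap of two perfect matchings\<close>

text \<open>Expanding \<open>x = (x - 1) + 1\<close> on each common edge gives a sum over common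
  subsets \<open>S\<close>. After exchanging sums, the number of \<open>H'\<close> containing
  \<open>S\<close> depends only on \<open>card S\<close>.\<close>

lemma sum_matchings_power:
  fixes x :: real
  assumes "finite V" "card V = 2 * h" "H \<in> matchings_on V"
  shows "(\<Sum>H'\<in>matchings_on V. x ^ card (H \<inter> H')) =
    (\<Sum>j\<le>h. real (h choose j) * (x - 1) ^ j * real (matching_number (h - j)))"
proof -
  have finH: "finite H" using assms by (auto simp: matchings_on_def intro: finite_subset[of _ "Pow V"])
  have cH: "card H = h" using card_matching[OF assms] .
  have "x ^ card (H \<inter> H') = (\<Sum>S | S \<subseteq> H \<and> S \<subseteq> H'. (x - 1) ^ card S)" for H'
  proof -
    have "x ^ card (H \<inter> H') = (\<Prod>e\<in>H \<inter> H'. (x - 1) + 1)" by simp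
    also have "\<dots> = (\<Sum>S\<in>Pow (H \<inter> H'). (x - 1) ^ card S)"
      using finH by (subst prod_add) auto
    also have "Pow (H \<inter> H') = {S. S \<subseteq> H \<and> S \<subseteq> H'}" by auto
    finally show ?thesis .
  qed
  then have "(\<Sum>H'\<in>matchings_on V. x ^ card (H \<inter> H')) =
      (\<Sum>H'\<in>matchings_on V. \<Sum>S\<in>{S \<in> Pow H. S \<subseteq> H'}. (x - 1) ^ card S)"
    by simp
  also have "\<dots> = (\<Sum>S\<in>Pow H. \<Sum>H' | H' \<in> matchings_on V \<and> S \<subseteq> H'. (x - 1) ^ card S)"
    using finH finite_matchings_on[OF assms(1)] by (intro sum.swap_restrict) auto
  also have "\<dots> = (\<Sum>S\<in>Pow H. (x - 1) ^ card S * real (matching_number (h - card S)))"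
    using card_matchings_containing[OF assms] by (intro sum.cong refl) simp
  also have "\<dots> = (\<Sum>j\<le>h. \<Sum>S | S \<in> Pow H \<and> card S = j. (x - 1) ^ card S * real (matching_number (h - card S)))"
    using finH card_mono[OF finH] cH by (intro sum.group[symmetric]) auto
  also have "\<dots> = (\<Sum>j\<le>h. real (h choose j) * (x - 1) ^ j * real (matching_number (h - j)))"
    using n_subsets[OF finH] cH by (intro sum.cong refl) (simp add: Pow_def)
  finally show ?thesis .
qed

text \<open>This is the product of \<open>(2 h - 2 i) / (2 h - 2 i - 1)\<close> over \<open>i < j\<close>, i.e. the ratio of the
  \<open>j\<close>-th factorial moment of \<open>card (H \<inter> H')\<close> to that of a Poisson variable of mean \<open>1/2\<close>.\<close>

definition matching_coeff :: "nat \<Rightarrow> nat \<Rightarrow> real" where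
  "matching_coeff h j =
    2 ^ j * fact j * real (h choose j) * real (matching_number (h - j)) / real (matching_number h)"

lemma matching_coeff_0 [simp]: "matching_coeff h 0 = 1"
  using matching_number_pos[of h] by (simp add: matching_coeff_def)

lemma matching_coeff_nonneg: "matching_coeff h j \<ge> 0"
  by (simp add: matching_coeff_def)

text \<open>Absorption for the binomial and the recursion of \<open>matching_number\<close> give the
  ratio of consecutive coefficients.\<close>

lemma matching_coeff_Suc:
  assumes "j < h"
  shows "matching_coeff h (Suc j) * (2 * real (h - j) - 1) = 2 * real (h - j) * matching_coeff h j"
proof -
  obtain i where "h - j = Suc i" "h - Suc j = i" using assms by (metis Suc_diff_Suc)
  then have D: "real (matching_number (h - j)) = (2 * real (h - j) - 1) * real (matching_number (h - Suc j))"
    by (simp add: algebra_simps)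
  have "Suc j * (h choose Suc j) = (h - j) * (h choose j)"
    by (metis binomial_absorb_comp binomial_absorption diff_Suc_1 mult.commute)
  then have C: "real (Suc j) * real (h choose Suc j) = real (h - j) * real (h choose j)"
    by (metis of_nat_mult)
  have "matching_coeff h (Suc j) * (2 * real (h - j) - 1) =
     2 * 2 ^ j * fact j * (real (Suc j) * real (h choose Suc j))
       * ((2 * real (h - j) - 1) * real (matching_number (h - Suc j))) / real (matching_number h)"
    unfolding matching_coeff_def fact_Suc power_Suc by (simp only: mult_ac times_divide_eq_right times_divide_eq_left)
  then show ?thesis
    unfolding C D[symmetric] matching_coeff_def by (simp only: mult_ac times_divide_eq_right times_divide_eq_left)
qed

text \<open>With \<open>m = h - j\<close>, each ratio \<open>2 m / (2 m - 1)\<close> is at most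
  \<open>m / (m - 1)\<close> while \<open>m \<ge> 2\<close>, and these bounds telescope to
  \<open>h / (h - j)\<close>.\<close>

lemma matching_coeff_mult_le:
  assumes "j < h"
  shows "matching_coeff h j * real (h - j) \<le> real h"
  using assms
proof (induction j)
  case (Suc j)
  define m where "m = real (h - j)"
  have m: "m \<ge> 2" "real (h - Suc j) = m - 1" using Suc.prems by (auto simp: m_def)
  have "matching_coeff h (Suc j) * (2 * (m - 1)) \<le> matching_coeff h (Suc j) * (2 * m - 1)"
    using m by (intro mult_left_mono matching_coeff_nonneg) auto
  also have "\<dots> = 2 * (matching_coeff h j * m)"
    using matching_coeff_Suc[of j h] Suc.prems by (simp add: m_def mult_ac)
  also have "\<dots> \<le> 2 * real h"
    using Suc by (simp add: m_def)
  finally show ?case unfolding m(2) by linarith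
qed simp

text \<open>For \<open>j\<close> up to \<open>h / 2\<close>, the telescoped bound is
  \<open>1 + j / (h - j)\<close>, at most \<open>1 + 2 j / h\<close>. For larger \<open>j\<close>
  the crude bound \<open>2 h\<close> suffices, since the quadratic term alone is at least that
  large.\<close>

lemma matching_coeff_le:
  assumes "j \<le> h" "0 < h"
  shows "matching_coeff h j \<le> 1 + 8 * (real j)\<^sup>2 / real h"
proof (cases "2 * j \<le> h")
  case True
  show ?thesis
  proof (cases "j = 0")
    case False
    have d: "0 < real (h - j)" "real (h - j) = real h - real j" using True False by auto
    have "matching_coeff h j \<le> real h / real (h - j)"
      using matching_coeff_mult_le[of j h] True False d by (simp add: pos_le_divide_eq)
    also have "\<dots> = 1 + real j / (real h - real j)"
      using d by (simp add: field_simps)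
    also have "real j / (real h - real j) \<le> real j / (real h / 2)"
      using True d assms by (intro divide_left_mono mult_pos_pos) auto
    also have "\<dots> \<le> 8 * (real j)\<^sup>2 / real h"
      using False assms by (simp add: divide_right_mono power2_eq_square)
    finally show ?thesis by simp
  qed simp
next
  case False
  have lt: "matching_coeff h i \<le> real h" if "i < h" for i
  proof -
    have "matching_coeff h i * 1 \<le> matching_coeff h i * real (h - i)"
      using that by (intro mult_left_mono matching_coeff_nonneg) auto
    then show ?thesis using matching_coeff_mult_le[OF that] by simp
  qed
  have "matching_coeff h j \<le> 2 * real h"
  proof (cases "j = h")
    case True
    \<comment> \<open>The telescoped bound stops before \<open>j = h\<close>; the last ratio equals
      2, hence the factor 2 in \<open>2 * real h\<close>.\<close>
    then obtain i where i: "h = Suc i" using assms by (cases h) auto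
    show ?thesis using matching_coeff_Suc[of i h] lt[of i] i True by simp
  qed (use lt[of j] assms in auto)
  also have "2 * real h \<le> 8 * (real j)\<^sup>2 / real h"
  proof -
    have "(real h)\<^sup>2 \<le> (2 * real j)\<^sup>2" using False by (intro power_mono) auto
    then show ?thesis using assms by (simp add: field_simps power2_eq_square)
  qed
  finally show ?thesis by simp
qed

text \<open>For \<open>y \<ge> 0\<close> this is the unnormalised second moment of a Poisson
  variable of mean \<open>y\<close>. Factors \<open>j\<close> are absorbed into the factorial by
  index shifts, the term at \<open>j = 0\<close> being zero.\<close>

lemma sums_square_exp:
  "(\<lambda>j. (real j)\<^sup>2 * (y ^ j / fact j)) sums ((y\<^sup>2 + y) * exp (y :: real))"
proof -
  have e: "(\<lambda>j. y ^ j / fact j) sums exp y"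
    using exp_converges[of y] by (simp add: field_simps)
  have "(\<lambda>j. real j * (y ^ j / fact j)) sums (y * exp y)"
  proof -
    have "(\<lambda>j. real (Suc j) * (y ^ Suc j / fact (Suc j))) sums (y * exp y)"
      using sums_mult[OF e, of y] by (simp add: field_simps del: of_nat_Suc)
    then show ?thesis
      by (subst (asm) sums_Suc_iff) simp
  qed
  then have "(\<lambda>j. y * (real j * (y ^ j / fact j)) + y * (y ^ j / fact j)) sums (y * (y * exp y) + y * exp y)"
    by (intro sums_add sums_mult e)
  then have s: "(\<lambda>j. y * (real (Suc j) * (y ^ j / fact j))) sums ((y\<^sup>2 + y) * exp y)"
    by (simp add: algebra_simps power2_eq_square add_divide_distrib)
  have "(\<lambda>j. (real (Suc j))\<^sup>2 * (y ^ Suc j / fact (Suc j))) sums ((y\<^sup>2 + y) * exp y)"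
    using s by (simp add: power2_eq_square field_simps del: of_nat_Suc)
  then show ?thesis
    by (subst (asm) sums_Suc_iff) simp
qed

text \<open>After normalisation the coefficient of \<open>y ^ j / fact j\<close> is
  \<open>matching_coeff h j\<close>. It is replaced by its upper bound, and the sum is completed to
  a series whose terms are nonnegative because \<open>1 \<le> x\<close>.\<close>

lemma sum_matchings_power_le:
  fixes x :: real
  assumes "finite V" "card V = 2 * h" "H \<in> matchings_on V" "0 < h" "1 \<le> x"
  defines "y \<equiv> (x - 1) / 2"
  shows "(\<Sum>H'\<in>matchings_on V. x ^ card (H \<inter> H')) / card (matchings_on V)
    \<le> exp y * (1 + 8 * (y\<^sup>2 + y) / real h)"
proof -
  have "(\<Sum>H'\<in>matchings_on V. x ^ card (H \<inter> H')) / card (matchings_on V) =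
      (\<Sum>j\<le>h. matching_coeff h j * (y ^ j / fact j))"
    unfolding sum_matchings_power[OF assms(1-3)] card_matchings_on[OF assms(1,2)] sum_divide_distrib
    by (intro sum.cong refl) (simp add: matching_coeff_def y_def power_divide)
  also have "\<dots> \<le> (\<Sum>j\<le>h. (1 + 8 * (real j)\<^sup>2 / real h) * (y ^ j / fact j))"
    using assms matching_coeff_le by (intro sum_mono mult_right_mono) (auto simp: y_def)
  also have "\<dots> = (\<Sum>j\<le>h. y ^ j / fact j + 8 / real h * ((real j)\<^sup>2 * (y ^ j / fact j)))"
    by (intro sum.cong refl) (simp add: algebra_simps)
  also have "\<dots> \<le> exp y + 8 / real h * ((y\<^sup>2 + y) * exp y)"
  proof -
    have "(\<lambda>j. y ^ j / fact j) sums exp y"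
      using exp_converges[of y] by (simp add: field_simps)
    then have "(\<lambda>j. y ^ j / fact j + 8 / real h * ((real j)\<^sup>2 * (y ^ j / fact j))) sums
        (exp y + 8 / real h * ((y\<^sup>2 + y) * exp y))"
      by (intro sums_add sums_mult sums_square_exp)
    then show ?thesis
      unfolding sums_iff using assms(5) by (metis (no_types, lifting) sum_le_suminf finite_atMost y_def
        add_nonneg_nonneg mult_nonneg_nonneg divide_nonneg_nonneg of_nat_0_le_iff zero_le_power
        diff_ge_0_iff_ge fact_ge_zero zero_le_numeral zero_le_power2)
  qed
  finally show ?thesis by (simp add: algebra_simps add_divide_distrib)
qed

subsection \<open>Stars and pairs of adjacent edges\<close>

lemma complete_edges_card: "real (card (complete_edges n)) = real n * (real n - 1) / 2"
proof -
  have "card (complete_edges n) = n choose 2"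
    unfolding complete_edges_def using n_subsets[of "{1..n}" 2] by simp
  then show ?thesis by (cases n) (auto simp: choose_two real_of_nat_div algebra_simps)
qed

definition star :: "nat \<Rightarrow> nat \<Rightarrow> nat set set" where
  "star n v = {e \<in> complete_edges n. v \<in> e}"

lemma finite_star [simp]: "finite (star n v)"
  by (simp add: star_def finite_complete_edges)

lemma card_star:
  assumes "v \<in> {1..n}"
  shows "card (star n v) = n - 1"
proof -
  have "star n v = (\<lambda>w. {v, w}) ` ({1..n} - {v})"
    using assms by (auto simp: star_def complete_edges_def card_2_iff)
  moreover have "inj_on (\<lambda>w. {v, w}) ({1..n} - {v})"
    by (auto simp: inj_on_def doubleton_eq_iff)
  ultimately show ?thesis using assms by (simp add: card_image)
qed

text \<open>Double counting: every edge has two endpoints.\<close>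

lemma sum_star_sum:
  fixes f :: "nat set \<Rightarrow> real"
  shows "(\<Sum>v\<in>{1..n}. \<Sum>e\<in>star n v. f e) = 2 * (\<Sum>e\<in>complete_edges n. f e)"
proof -
  have "(\<Sum>v\<in>{1..n}. \<Sum>e\<in>star n v. f e) =
      (\<Sum>e\<in>complete_edges n. \<Sum>v | v \<in> {1..n} \<and> v \<in> e. f e)"
    unfolding star_def by (rule sum.swap_restrict) (auto simp: finite_complete_edges)
  also have "\<dots> = (\<Sum>e\<in>complete_edges n. 2 * f e)"
  proof (rule sum.cong[OF refl])
    fix e assume "e \<in> complete_edges n"
    then have "{v. v \<in> {1..n} \<and> v \<in> e} = e" "card e = 2" by (auto simp: complete_edges_def)
    then show "(\<Sum>v | v \<in> {1..n} \<and> v \<in> e. f e) = 2 * f e" by simp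
  qed
  finally show ?thesis by (simp add: sum_distrib_left)
qed

definition wedges :: "nat \<Rightarrow> nat set set set" where
  "wedges n = (\<Union>v\<in>{1..n}. {S. S \<subseteq> star n v \<and> card S = 2})"

text \<open>The only edge through distinct \<open>v\<close> and \<open>w\<close> is
  \<open>{v, w}\<close>, so two distinct edges have at most one common vertex. This makes the union
  defining \<open>wedges\<close> disjoint.\<close>

lemma star_inter:
  assumes "e \<in> star n v" "f \<in> star n v" "e \<in> star n w" "f \<in> star n w" "e \<noteq> f"
  shows "v = w"
proof (rule ccontr)
  assume "v \<noteq> w"
  then have "e = {v, w}" "f = {v, w}"
    using assms by (auto simp: star_def complete_edges_def card_2_iff)
  with assms show False by simp
qed

lemma sum_wedges:
  fixes f :: "nat set set \<Rightarrow> real"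
  shows "(\<Sum>S\<in>wedges n. f S) = (\<Sum>v\<in>{1..n}. \<Sum>S | S \<subseteq> star n v \<and> card S = 2. f S)"
  unfolding wedges_def
proof (rule sum.UNION_disjoint)
  show "\<forall>v\<in>{1..n}. \<forall>w\<in>{1..n}. v \<noteq> w \<longrightarrow>
      {S. S \<subseteq> star n v \<and> card S = 2} \<inter> {S. S \<subseteq> star n w \<and> card S = 2} = {}"
    using star_inter by (fastforce simp: card_2_iff)
qed auto

lemma card_wedges_le: "real (card (wedges n)) \<le> real n ^ 3 / 2"
proof -
  have "real (card (wedges n)) = (\<Sum>v\<in>{1..n}. \<Sum>S | S \<subseteq> star n v \<and> card S = 2. 1)"
    using sum_wedges[of "\<lambda>_. 1" n] by simp
  also have "\<dots> = (\<Sum>v\<in>{1..n}. real ((n - 1) choose 2))"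
    by (intro sum.cong refl) (simp add: n_subsets card_star)
  also have "\<dots> \<le> (\<Sum>v\<in>{1..n}. (real n)\<^sup>2 / 2)"
  proof (rule sum_mono)
    have "real (k div 2) \<le> real k / 2" for k :: nat by linarith
    then have "real ((n - 1) choose 2) \<le> real ((n - 1) * (n - 1 - 1)) / 2"
      unfolding choose_two .
    also have "real ((n - 1) * (n - 1 - 1)) \<le> (real n)\<^sup>2"
      unfolding power2_eq_square of_nat_mult[symmetric] of_nat_le_iff by (intro mult_mono) auto
    finally show "real ((n - 1) choose 2) \<le> (real n)\<^sup>2 / 2" by simp
  qed
  finally show ?thesis by (simp add: power2_eq_square power3_eq_cube)
qed

text \<open>Each unordered off-diagonal pair occurs twice in the square. The products over
  two-element sets match the monomials of \<open>second_moment_centered_polynomial\<close>.\<close>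

lemma square_sum_eq_pairs:
  fixes f :: "'a \<Rightarrow> real"
  assumes "finite A"
  shows "(\<Sum>e\<in>A. f e)\<^sup>2 - (\<Sum>e\<in>A. (f e)\<^sup>2) = 2 * (\<Sum>S | S \<subseteq> A \<and> card S = 2. \<Prod>e\<in>S. f e)"
  using assms
proof (induction A rule: finite_induct)
  case (insert a A)
  have split: "{S. S \<subseteq> insert a A \<and> card S = 2} =
      {S. S \<subseteq> A \<and> card S = 2} \<union> (\<lambda>b. {a, b}) ` A" (is "?L = ?R1 \<union> ?R2")
  proof (rule set_eqI)
    fix S show "S \<in> ?L \<longleftrightarrow> S \<in> ?R1 \<union> ?R2"
      using insert.hyps(2) by (auto simp: card_2_iff doubleton_eq_iff subset_insert_iff)
  qed
  have "(\<Sum>S | S \<subseteq> insert a A \<and> card S = 2. \<Prod>e\<in>S. f e) =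
      (\<Sum>S | S \<subseteq> A \<and> card S = 2. \<Prod>e\<in>S. f e) + (\<Sum>S\<in>(\<lambda>b. {a, b}) ` A. \<Prod>e\<in>S. f e)"
    unfolding split using insert.hyps by (intro sum.union_disjoint) auto
  also have "(\<Sum>S\<in>(\<lambda>b. {a, b}) ` A. \<Prod>e\<in>S. f e) = (\<Sum>b\<in>A. \<Prod>e\<in>{a, b}. f e)"
    by (subst sum.reindex) (auto simp: inj_on_def doubleton_eq_iff)
  also have "\<dots> = (\<Sum>b\<in>A. f a * f b)"
  proof (rule sum.cong[OF refl])
    fix b assume "b \<in> A"
    then have "a \<noteq> b" using insert.hyps by auto
    then show "(\<Prod>e\<in>{a, b}. f e) = f a * f b" by simp
  qed
  also have "\<dots> = f a * (\<Sum>b\<in>A. f b)" by (simp add: sum_distrib_left)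
  finally show ?case
    using insert by (simp add: power2_sum algebra_simps)
qed (auto simp: card_2_iff)

subsection \<open>The signed count of adjacent edge pairs\<close>

text \<open>Twice the sum of \<open>(G_e - c) (G_f - c)\<close> over the unordered pairs \<open>{e, f}\<close> of adjacent edges;
  for \<open>c = q\<close> the inner sum is a centred degree.\<close>

definition signed_wedges :: "nat \<Rightarrow> real \<Rightarrow> nat set set \<Rightarrow> real" where
  "signed_wedges n c G =
    (\<Sum>v\<in>{1..n}. (\<Sum>e\<in>star n v. of_bool (e \<in> G) - c)\<^sup>2 - (\<Sum>e\<in>star n v. (of_bool (e \<in> G) - c)\<^sup>2))"

text \<open>Split \<open>of_bool (e \<in> G) - c\<close> into noise \<open>Y e\<close> and shift
  \<open>m e\<close>. The shift sums to zero over each star, so it survives only through the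
  subtracted squares. Each edge lies in two stars, which doubles the constant and the linear term.
  The right side has mean zero under the weight \<open>\<theta>\<close>.\<close>

lemma signed_wedges_expand:
  fixes \<theta> :: "nat set \<Rightarrow> real"
  assumes "\<And>v. v \<in> {1..n} \<Longrightarrow> (\<Sum>e\<in>star n v. \<theta> e - c) = 0"
  shows "signed_wedges n c G + 2 * (\<Sum>e\<in>complete_edges n. (\<theta> e - c)\<^sup>2) =
    2 * (\<Sum>S\<in>wedges n. \<Prod>e\<in>S. of_bool (e \<in> G) - \<theta> e) -
    4 * (\<Sum>e\<in>complete_edges n. (\<theta> e - c) * (of_bool (e \<in> G) - \<theta> e))"
proof -
  define Y where "Y e = of_bool (e \<in> G) - \<theta> e" for e
  define m where "m e = \<theta> e - c" for e
  have X: "of_bool (e \<in> G) - c = Y e + m e" for e by (simp add: Y_def m_def)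
  have "(\<Sum>e\<in>star n v. Y e + m e)\<^sup>2 - (\<Sum>e\<in>star n v. (Y e + m e)\<^sup>2) =
      2 * (\<Sum>S | S \<subseteq> star n v \<and> card S = 2. \<Prod>e\<in>S. Y e)
      - 2 * (\<Sum>e\<in>star n v. m e * Y e) - (\<Sum>e\<in>star n v. (m e)\<^sup>2)" if "v \<in> {1..n}" for v
  proof -
    have "(\<Sum>e\<in>star n v. Y e + m e) = (\<Sum>e\<in>star n v. Y e)"
      using assms[OF that] by (simp add: sum.distrib m_def)
    moreover have "(\<Sum>e\<in>star n v. (Y e + m e)\<^sup>2) =
        (\<Sum>e\<in>star n v. (Y e)\<^sup>2) + 2 * (\<Sum>e\<in>star n v. m e * Y e) + (\<Sum>e\<in>star n v. (m e)\<^sup>2)"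
      by (simp add: power2_sum sum.distrib sum_distrib_left mult_ac)
    ultimately show ?thesis
      using square_sum_eq_pairs[of "star n v" Y] by simp
  qed
  then have "signed_wedges n c G = (\<Sum>v\<in>{1..n}. 2 * (\<Sum>S | S \<subseteq> star n v \<and> card S = 2. \<Prod>e\<in>S. Y e)
      - 2 * (\<Sum>e\<in>star n v. m e * Y e) - (\<Sum>e\<in>star n v. (m e)\<^sup>2))"
    unfolding signed_wedges_def X by (intro sum.cong refl) auto
  also have "\<dots> = 2 * (\<Sum>S\<in>wedges n. \<Prod>e\<in>S. Y e) - 4 * (\<Sum>e\<in>complete_edges n. m e * Y e)
      - 2 * (\<Sum>e\<in>complete_edges n. (m e)\<^sup>2)"
    unfolding sum_subtractf sum_distrib_left[symmetric] sum_star_sum sum_wedges by simp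
  finally show ?thesis
    by (simp add: Y_def m_def)
qed

text \<open>The recentred statistic is a polynomial in orthogonal monomials, with coefficient 2 at a
  wedge and \<open>- 4 * m e\<close> at an edge. There are at most \<open>n^3 / 2\<close> wedges and
  \<open>n^2 / 2\<close> edges.\<close>

lemma signed_wedges_second_moment:
  fixes \<theta> :: "nat set \<Rightarrow> real"
  assumes "\<And>v. v \<in> {1..n} \<Longrightarrow> (\<Sum>e\<in>star n v. \<theta> e - c) = 0"
    and "\<And>e. 0 \<le> \<theta> e * (1 - \<theta> e) \<and> \<theta> e * (1 - \<theta> e) \<le> b"
    and "\<And>e. (\<theta> e - c)\<^sup>2 * (\<theta> e * (1 - \<theta> e)) \<le> d"
  shows "(\<Sum>G\<in>graphs n. product_weight (complete_edges n) \<theta> G *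
      (signed_wedges n c G + 2 * (\<Sum>e\<in>complete_edges n. (\<theta> e - c)\<^sup>2))\<^sup>2)
    \<le> 2 * real n ^ 3 * b\<^sup>2 + 8 * (real n)\<^sup>2 * d"
proof -
  let ?E = "complete_edges n"
  define m where "m e = \<theta> e - c" for e
  \<comment> \<open>One coefficient function serves both kinds of monomials, told apart by
    cardinality; \<open>the_elem\<close> recovers the edge from a singleton.\<close>
  define a where "a S = (if card S = 2 then 2 else - 4 * m (the_elem S))" for S
  define F where "F = wedges n \<union> (\<lambda>e. {e}) ` ?E"
  have w: "S \<subseteq> ?E \<and> card S = 2" if "S \<in> wedges n" for S
    using that by (auto simp: wedges_def star_def)
  have fw: "finite (wedges n)" by (simp add: wedges_def)
  have F: "(\<Sum>S\<in>F. f S) = (\<Sum>S\<in>wedges n. f S) + (\<Sum>e\<in>?E. f {e})" for f :: "nat set set \<Rightarrow> real"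
  proof -
    have "(\<Sum>S\<in>F. f S) = (\<Sum>S\<in>wedges n. f S) + (\<Sum>S\<in>(\<lambda>e. {e}) ` ?E. f S)"
      unfolding F_def using w by (intro sum.union_disjoint) (fastforce simp: fw finite_complete_edges)+
    then show ?thesis by (simp add: sum.reindex)
  qed
  have "signed_wedges n c G + 2 * (\<Sum>e\<in>?E. (\<theta> e - c)\<^sup>2) =
      (\<Sum>S\<in>F. a S * (\<Prod>e\<in>S. of_bool (e \<in> G) - \<theta> e))" for G
  proof -
    have "(\<Sum>S\<in>wedges n. a S * (\<Prod>e\<in>S. of_bool (e \<in> G) - \<theta> e)) =
        2 * (\<Sum>S\<in>wedges n. \<Prod>e\<in>S. of_bool (e \<in> G) - \<theta> e)"
      unfolding sum_distrib_left using w by (intro sum.cong) (auto simp: a_def)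
    moreover have "(\<Sum>e\<in>?E. a {e} * (\<Prod>f\<in>{e}. of_bool (f \<in> G) - \<theta> f)) =
        - 4 * (\<Sum>e\<in>?E. m e * (of_bool (e \<in> G) - \<theta> e))"
      unfolding sum_distrib_left by (intro sum.cong) (auto simp: a_def mult.assoc)
    ultimately show ?thesis
      using signed_wedges_expand[where \<theta> = \<theta> and G = G, OF assms(1)] by (simp add: F m_def)
  qed
  moreover have "F \<subseteq> Pow ?E" using w by (auto simp: F_def)
  ultimately have "(\<Sum>G\<in>graphs n. product_weight ?E \<theta> G *
      (signed_wedges n c G + 2 * (\<Sum>e\<in>?E. (\<theta> e - c)\<^sup>2))\<^sup>2) =
      (\<Sum>S\<in>F. (a S)\<^sup>2 * (\<Prod>e\<in>S. \<theta> e * (1 - \<theta> e)))"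
    unfolding graphs_def using second_moment_centered_polynomial[OF finite_complete_edges] by simp
  also have "\<dots> = (\<Sum>S\<in>wedges n. 4 * (\<Prod>e\<in>S. \<theta> e * (1 - \<theta> e)))
      + (\<Sum>e\<in>?E. 16 * ((\<theta> e - c)\<^sup>2 * (\<theta> e * (1 - \<theta> e))))"
    unfolding F using w by (simp add: a_def power_mult_distrib mult_ac flip: m_def)
  also have "(\<Sum>S\<in>wedges n. 4 * (\<Prod>e\<in>S. \<theta> e * (1 - \<theta> e))) \<le> (\<Sum>S\<in>wedges n. 4 * b\<^sup>2)"
  proof (intro sum_mono mult_left_mono)
    fix S assume "S \<in> wedges n"
    then have "card S = 2" using w by simp
    moreover have "(\<Prod>e\<in>S. \<theta> e * (1 - \<theta> e)) \<le> (\<Prod>e\<in>S. b)"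
      by (rule prod_mono) (rule assms(2))
    ultimately show "(\<Prod>e\<in>S. \<theta> e * (1 - \<theta> e)) \<le> b\<^sup>2" by simp
  qed simp
  also have "\<dots> = real (card (wedges n)) * (4 * b\<^sup>2)" by simp
  also have "\<dots> \<le> (real n ^ 3 / 2) * (4 * b\<^sup>2)"
    by (intro mult_right_mono card_wedges_le) simp
  also have "(\<Sum>e\<in>?E. 16 * ((\<theta> e - c)\<^sup>2 * (\<theta> e * (1 - \<theta> e)))) \<le> (\<Sum>e\<in>?E. 16 * d)"
    using assms(3) by (intro sum_mono mult_left_mono) auto
  also have "\<dots> = (real n * (real n - 1) / 2) * (16 * d)"
    by (simp add: complete_edges_card[symmetric])
  also have "\<dots> \<le> ((real n)\<^sup>2 / 2) * (16 * d)"
  proof (intro mult_right_mono)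
    \<comment> \<open>The hypotheses hold at every \<open>e\<close>, so a single instance shows that
      \<open>d\<close> bounds a nonnegative quantity.\<close>
    show "0 \<le> 16 * d" using assms(2,3)[of undefined]
      by (metis mult_nonneg_nonneg order_trans zero_le_numeral zero_le_power2)
  qed (simp add: power2_eq_square algebra_simps)
  finally show ?thesis by (simp add: mult_ac)
qed

section \<open>Lower bound on the distance\<close>

lemma sum_star_matching:
  fixes a b :: real
  assumes "H \<in> perfect_matchings n" "v \<in> {1..n}" "2 \<le> n"
  shows "(\<Sum>e\<in>star n v. if e \<in> H then a else b) = a + (real n - 2) * b"
proof -
  have "\<exists>!e. e \<in> H \<and> v \<in> e" using assms by (simp add: perfect_matchings_def)
  then obtain e where e: "e \<in> H \<and> v \<in> e" "\<forall>f. f \<in> H \<and> v \<in> f \<longrightarrow> f = e"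
    by (rule ex1E)
  have "H \<subseteq> complete_edges n"
    using assms(1) by (simp add: perfect_matchings_def graphs_def)
  with e(1) have es: "e \<in> star n v" by (auto simp: star_def)
  have "(\<Sum>e\<in>star n v. if e \<in> H then a else b) = a + (\<Sum>f\<in>star n v - {e}. if f \<in> H then a else b)"
    using es e(1) by (simp add: sum.remove[of _ e])
  also have "(\<Sum>f\<in>star n v - {e}. if f \<in> H then a else b) = (\<Sum>f\<in>star n v - {e}. b)"
  proof (rule sum.cong[OF refl])
    fix f assume "f \<in> star n v - {e}"
    then have "f \<notin> H" using e(2) unfolding star_def by blast
    then show "(if f \<in> H then a else b) = b" by simp
  qed
  also have "\<dots> = (real n - 2) * b"
    using es assms by (simp add: card_star of_nat_diff)
  finally show ?thesis .
qed

text \<open>A pointwise Chebyshev argument, meant for \<open>W\<close> near \<open>-M\<close> under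
  \<open>P\<close> and near 0 under \<open>Q\<close>. Every point is at distance at least
  \<open>M / 2\<close> from one of these centres, so \<open>min (P x) (Q x)\<close> is charged to
  the corresponding square. Finally \<open>\<bar>P x - Q x\<bar>\<close> is \<open>P x + Q x\<close>
  minus twice the minimum.\<close>

lemma half_l1_dist_ge_chebyshev:
  fixes P Q W :: "'a \<Rightarrow> real"
  assumes "\<And>x. x \<in> \<Omega> \<Longrightarrow> 0 \<le> P x" "\<And>x. x \<in> \<Omega> \<Longrightarrow> 0 \<le> Q x"
    and "sum P \<Omega> = 1" "sum Q \<Omega> = 1" "0 < M"
  shows "1 - 4 / M\<^sup>2 * ((\<Sum>x\<in>\<Omega>. P x * (W x + M)\<^sup>2) + (\<Sum>x\<in>\<Omega>. Q x * (W x)\<^sup>2))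
    \<le> 1 / 2 * (\<Sum>x\<in>\<Omega>. \<bar>P x - Q x\<bar>)"
proof -
  have "P x + Q x - 8 / M\<^sup>2 * (P x * (W x + M)\<^sup>2 + Q x * (W x)\<^sup>2) \<le> \<bar>P x - Q x\<bar>" if x: "x \<in> \<Omega>" for x
  proof -
    have "4 / M\<^sup>2 * (P x * (W x + M)\<^sup>2 + Q x * (W x)\<^sup>2) \<ge> min (P x) (Q x)"
    proof (cases "W x \<le> - M / 2")
      case True
      then have "(M / 2)\<^sup>2 \<le> (- W x)\<^sup>2" using assms(5) by (intro power_mono) auto
      then have "Q x * (M\<^sup>2 / 4) \<le> Q x * (W x)\<^sup>2"
        using assms(2)[OF x] by (intro mult_left_mono) (auto simp: power_divide)
      also have "\<dots> \<le> P x * (W x + M)\<^sup>2 + Q x * (W x)\<^sup>2" using assms(1)[OF x] by simp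
      finally show ?thesis using assms(5) by (simp add: field_simps min_le_iff_disj)
    next
      case False
      then have "(M / 2)\<^sup>2 \<le> (W x + M)\<^sup>2" using assms(5) by (intro power_mono) auto
      then have "P x * (M\<^sup>2 / 4) \<le> P x * (W x + M)\<^sup>2"
        using assms(1)[OF x] by (intro mult_left_mono) (auto simp: power_divide)
      also have "\<dots> \<le> P x * (W x + M)\<^sup>2 + Q x * (W x)\<^sup>2" using assms(2)[OF x] by simp
      finally show ?thesis using assms(5) by (simp add: field_simps min_le_iff_disj)
    qed
    moreover define r where "r = 4 / M\<^sup>2 * (P x * (W x + M)\<^sup>2 + Q x * (W x)\<^sup>2)"
    moreover have "8 / M\<^sup>2 * (P x * (W x + M)\<^sup>2 + Q x * (W x)\<^sup>2) = 2 * r"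
      by (simp add: r_def)
    ultimately show ?thesis by linarith
  qed
  then have "(\<Sum>x\<in>\<Omega>. P x + Q x - 8 / M\<^sup>2 * (P x * (W x + M)\<^sup>2 + Q x * (W x)\<^sup>2)) \<le> (\<Sum>x\<in>\<Omega>. \<bar>P x - Q x\<bar>)"
    by (intro sum_mono)
  then show ?thesis
    unfolding sum_subtractf sum.distrib sum_distrib_left[symmetric] assms(3,4) by simp
qed


lemma planted_prob_minus: "planted_prob p H e - q = (if e \<in> H then 1 - q else p - q)"
  by (simp add: planted_prob_def)

text \<open>The Chebyshev argument for the signed wedge count centred at \<open>q\<close>. As
  \<open>M \<ge> n / 9\<close>, the prefactor is at most \<open>324 / n^2\<close>; it multiplies the
  second moment bound \<open>6 n^3 p^2 + 48 n\<close>.\<close>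

lemma tv_dist_lower_bound:
  assumes "even n" "4 \<le> n" "0 \<le> p" "p \<le> 1 / 2" and q: "q = p + (1 - p) / (real n - 1)"
  shows "1 - 1944 * (p * sqrt (real n))\<^sup>2 - 15552 / real n
    \<le> graph_tv_dist n (planted_matching n p) (erdos_renyi n q)"
proof -
  let ?E = "complete_edges n" and ?PM = "perfect_matchings n" and ?W = "signed_wedges n q"
  let ?P = "pmf (planted_matching n p)" and ?Q = "pmf (erdos_renyi n q)"
  have n: "4 \<le> real n" using assms(2) by simp
  have gap: "q - p = (1 - p) / (real n - 1)" "(1 - p) / (real n - 1) \<le> 1 / (real n - 1)"
    using assms n by (auto intro!: divide_right_mono)
  have "1 / (real n - 1) \<le> 2 / real n" using n by (simp add: field_simps)
  then have qp: "0 \<le> q - p" "q - p \<le> 2 / real n" using gap assms n by auto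
  have "1 - q = (1 - p) * ((real n - 2) / (real n - 1))"
    using n by (simp add: q field_simps)
  also have "\<dots> \<ge> 1 / 2 * (2 / 3)"
    using assms n by (intro mult_mono) (auto simp: field_simps)
  finally have q1: "1 / 3 \<le> 1 - q" by simp
  \<comment> \<open>Each star has one planted edge, shifted from \<open>q\<close> by
    \<open>1 - q\<close>, and \<open>n - 2\<close> others shifted by \<open>p - q\<close>. Thus
    \<open>M\<close> sums the squared shifts over all stars, and \<open>-M\<close> is the planted
    mean of \<open>?W\<close> for every \<open>H\<close>.\<close>
  define M where "M = real n * ((1 - q)\<^sup>2 + (real n - 2) * (p - q)\<^sup>2)"
  have "real n * (1 / 3)\<^sup>2 \<le> M"
    unfolding M_def using n q1 by (intro mult_left_mono add_increasing2 power_mono) auto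
  then have M: "real n / 9 \<le> M" by (simp add: power2_eq_square)
  \<comment> \<open>The first sum vanishes because expected degrees agree:
    \<open>(n - 1) q = 1 + (n - 2) p\<close>.\<close>
  have drift: "(\<Sum>e\<in>star n v. planted_prob p H e - q) = 0"
    "2 * (\<Sum>e\<in>?E. (planted_prob p H e - q)\<^sup>2) = M" if H: "H \<in> ?PM" and v: "v \<in> {1..n}" for H v
  proof -
    have "(\<Sum>e\<in>star n v. planted_prob p H e - q) = (1 - q) + (real n - 2) * (p - q)"
      unfolding planted_prob_minus using H v n by (intro sum_star_matching) auto
    also have "\<dots> = 0" using n by (simp add: q field_simps)
    finally show "(\<Sum>e\<in>star n v. planted_prob p H e - q) = 0" .
    have "2 * (\<Sum>e\<in>?E. (planted_prob p H e - q)\<^sup>2) =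
        (\<Sum>v\<in>{1..n}. \<Sum>e\<in>star n v. if e \<in> H then (1 - q)\<^sup>2 else (p - q)\<^sup>2)"
      unfolding sum_star_sum planted_prob_minus by (intro arg_cong2[of _ _ _ _ "(*)"] sum.cong) auto
    also have "\<dots> = M"
      using H n by (simp add: sum_star_matching M_def)
    finally show "2 * (\<Sum>e\<in>?E. (planted_prob p H e - q)\<^sup>2) = M" .
  qed
  have N: "real (card ?PM) > 0"
    using perfect_matchings_nonempty[OF assms(1)] finite_perfect_matchings[of n] by (simp add: card_gt_0_iff)
  have PW: "(\<Sum>G\<in>graphs n. ?P G * (?W G + M)\<^sup>2) \<le> 2 * real n ^ 3 * p\<^sup>2 + 8 * (real n)\<^sup>2 * ((q - p)\<^sup>2 * p)"
    (is "_ \<le> ?VP")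
  proof -
    \<comment> \<open>A planted edge has variance zero, so \<open>b = p\<close> and
      \<open>d = (q - p)^2 * p\<close> only have to cover unplanted edges. As \<open>M\<close> is
      the same for all \<open>H\<close>, the bound passes to the mixture.\<close>
    have one: "(\<Sum>G\<in>graphs n. product_weight ?E (planted_prob p H) G * (?W G + M)\<^sup>2) \<le> ?VP" if H: "H \<in> ?PM" for H
    proof -
      have "1 \<in> {1..n}" using assms(2) by simp
      then have "M = 2 * (\<Sum>e\<in>?E. (planted_prob p H e - q)\<^sup>2)" using drift(2)[OF H] by metis
      moreover have "p * (1 - p) \<le> p" "0 \<le> p * (1 - p)" using assms by (simp_all add: mult_left_le)
      then have "(p - q)\<^sup>2 * (p * (1 - p)) \<le> (q - p)\<^sup>2 * p"
        by (simp only: power2_commute[of p q]) (intro mult_left_mono, auto)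
      ultimately show ?thesis
        using drift(1)[OF H] assms(3,4) \<open>p * (1 - p) \<le> p\<close>
        by (simp only:) (rule signed_wedges_second_moment, auto simp: planted_prob_def)
    qed
    have "(\<Sum>G\<in>graphs n. ?P G * (?W G + M)\<^sup>2) =
        (\<Sum>G\<in>graphs n. \<Sum>H\<in>?PM. product_weight ?E (planted_prob p H) G * (?W G + M)\<^sup>2 / card ?PM)"
      using assms by (intro sum.cong refl)
        (simp add: pmf_planted_matching sum_distrib_right sum_divide_distrib)
    also have "\<dots> = (\<Sum>H\<in>?PM. (\<Sum>G\<in>graphs n. product_weight ?E (planted_prob p H) G * (?W G + M)\<^sup>2) / card ?PM)"
      unfolding sum_divide_distrib by (rule sum.swap)
    also have "\<dots> \<le> (\<Sum>H\<in>?PM. ?VP / card ?PM)"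
      using one by (intro sum_mono divide_right_mono) auto
    also have "\<dots> = ?VP" using N by simp
    finally show ?thesis .
  qed
  \<comment> \<open>Under the null model every edge probability is \<open>q\<close>, so all shifts
    vanish and \<open>d = 0\<close> is admissible.\<close>
  have QW: "(\<Sum>G\<in>graphs n. ?Q G * (?W G)\<^sup>2) \<le> 2 * real n ^ 3 * q\<^sup>2"
  proof -
    have q01: "0 \<le> q" "q \<le> 1" using qp(1) assms(3) q1 by linarith+
    then have "(\<Sum>G\<in>graphs n. ?Q G * (?W G)\<^sup>2) =
      (\<Sum>G\<in>graphs n. product_weight ?E (\<lambda>_. q) G * (?W G + 2 * (\<Sum>e\<in>?E. (q - q)\<^sup>2))\<^sup>2)"
      by (intro sum.cong refl) (simp add: pmf_erdos_renyi)
    also have "\<dots> \<le> 2 * real n ^ 3 * q\<^sup>2 + 8 * (real n)\<^sup>2 * 0"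
      using q01 by (intro signed_wedges_second_moment) (auto simp: mult_left_le)
    finally show ?thesis by simp
  qed
  have "1 - 4 / M\<^sup>2 * ((\<Sum>G\<in>graphs n. ?P G * (?W G + M)\<^sup>2) + (\<Sum>G\<in>graphs n. ?Q G * (?W G)\<^sup>2))
      \<le> graph_tv_dist n (planted_matching n p) (erdos_renyi n q)"
    unfolding graph_tv_dist_def
    using M n sum_pmf_erdos_renyi sum_pmf_planted_matching[OF assms(1)]
    by (intro half_l1_dist_ge_chebyshev) auto
  moreover have "4 / M\<^sup>2 * ((\<Sum>G\<in>graphs n. ?P G * (?W G + M)\<^sup>2) + (\<Sum>G\<in>graphs n. ?Q G * (?W G)\<^sup>2))
      \<le> 4 / (real n / 9)\<^sup>2 * (6 * real n ^ 3 * p\<^sup>2 + 48 * real n)"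
  proof (intro mult_mono)
    show "4 / M\<^sup>2 \<le> 4 / (real n / 9)\<^sup>2"
      using M n by (intro divide_left_mono power_mono mult_pos_pos) auto
    \<comment> \<open>Since \<open>q - p \<le> 2 / n\<close>, the planted law contributes at most
      \<open>2 n^3 p^2 + 32 n\<close> and the null law at most
      \<open>4 n^3 p^2 + 16 n\<close>.\<close>
    have g2: "(q - p)\<^sup>2 \<le> 4 / (real n)\<^sup>2"
      using power_mono[OF qp(2,1), of 2] by (simp add: power_divide)
    have "q\<^sup>2 \<le> 2 * p\<^sup>2 + 2 * (q - p)\<^sup>2"
      using zero_le_power2[of "q - 2 * p"] by (simp add: power2_eq_square algebra_simps)
    also have "\<dots> \<le> 2 * p\<^sup>2 + 8 / (real n)\<^sup>2" using g2 by simp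
    finally have "2 * real n ^ 3 * q\<^sup>2 \<le> 2 * real n ^ 3 * (2 * p\<^sup>2 + 8 / (real n)\<^sup>2)"
      by (intro mult_left_mono) auto
    also have "\<dots> = 4 * real n ^ 3 * p\<^sup>2 + 16 * real n"
      using n by (simp add: field_simps power2_eq_square power3_eq_cube)
    finally have a: "2 * real n ^ 3 * q\<^sup>2 \<le> 4 * real n ^ 3 * p\<^sup>2 + 16 * real n" .
    have "8 * (real n)\<^sup>2 * ((q - p)\<^sup>2 * p) \<le> 8 * (real n)\<^sup>2 * (4 / (real n)\<^sup>2 * 1)"
      using assms g2 by (intro mult_left_mono mult_mono) auto
    also have "\<dots> = 32" using n by simp
    also have "\<dots> \<le> 32 * real n" using n by simp
    finally show "(\<Sum>G\<in>graphs n. ?P G * (?W G + M)\<^sup>2) + (\<Sum>G\<in>graphs n. ?Q G * (?W G)\<^sup>2)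
        \<le> 6 * real n ^ 3 * p\<^sup>2 + 48 * real n"
      using PW QW a by linarith
  qed (auto intro!: add_nonneg_nonneg sum_nonneg)
  moreover have "4 / (real n / 9)\<^sup>2 * (6 * real n ^ 3 * p\<^sup>2 + 48 * real n) =
      1944 * (p * sqrt (real n))\<^sup>2 + 15552 / real n"
    using n by (simp add: field_simps power2_eq_square power3_eq_cube)
  ultimately show ?thesis by linarith
qed

subsection \<open>The chi-square divergence\<close>

text \<open>Cauchy-Schwarz for \<open>\<bar>P x - Q x\<bar> / sqrt (Q x)\<close> and
  \<open>sqrt (Q x)\<close>; expanding the first square with both masses equal to 1 leaves the
  chi-square sum minus one.\<close>

lemma half_l1_dist_le_chi_square:
  fixes P Q :: "'a \<Rightarrow> real"
  assumes "\<And>x. x \<in> \<Omega> \<Longrightarrow> 0 < Q x" "sum P \<Omega> = 1" "sum Q \<Omega> = 1"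
  shows "1 / 2 * (\<Sum>x\<in>\<Omega>. \<bar>P x - Q x\<bar>) \<le> 1 / 2 * sqrt ((\<Sum>x\<in>\<Omega>. (P x)\<^sup>2 / Q x) - 1)"
proof -
  have "(\<Sum>x\<in>\<Omega>. \<bar>P x - Q x\<bar>)\<^sup>2 = (\<Sum>x\<in>\<Omega>. \<bar>P x - Q x\<bar> / sqrt (Q x) * sqrt (Q x))\<^sup>2"
    using assms(1) by (intro arg_cong[where f = "\<lambda>z. z\<^sup>2"] sum.cong) (simp_all add: less_imp_neq[symmetric])
  also have "\<dots> \<le> (\<Sum>x\<in>\<Omega>. (\<bar>P x - Q x\<bar> / sqrt (Q x))\<^sup>2) * (\<Sum>x\<in>\<Omega>. (sqrt (Q x))\<^sup>2)"
    by (rule Cauchy_Schwarz_ineq_sum)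
  also have "(\<Sum>x\<in>\<Omega>. (sqrt (Q x))\<^sup>2) = 1"
    using assms(1) by (subst assms(3)[symmetric], intro sum.cong) (auto simp: less_imp_le)
  also have "(\<Sum>x\<in>\<Omega>. (\<bar>P x - Q x\<bar> / sqrt (Q x))\<^sup>2) = (\<Sum>x\<in>\<Omega>. (P x)\<^sup>2 / Q x - 2 * P x + Q x)"
  proof (rule sum.cong[OF refl])
    fix x assume "x \<in> \<Omega>"
    then have "0 < Q x" by (rule assms(1))
    then show "(\<bar>P x - Q x\<bar> / sqrt (Q x))\<^sup>2 = (P x)\<^sup>2 / Q x - 2 * P x + Q x"
      by (simp add: power_divide power2_diff add_divide_distrib diff_divide_distrib)
        (simp add: power2_eq_square)
  qed
  also have "\<dots> = (\<Sum>x\<in>\<Omega>. (P x)\<^sup>2 / Q x) - 1"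
    using assms(2,3) by (simp add: sum.distrib sum_subtractf sum_distrib_left[symmetric])
  finally show ?thesis by (simp add: real_le_rsqrt)
qed

text \<open>These are the cross terms in the chi-square sum of a mixture; likelihood ratios multiply
  edgewise, so the sum factorises.\<close>

lemma sum_product_weight_ratio:
  assumes "finite E"
  shows "(\<Sum>G\<in>Pow E. product_weight E \<theta> G * product_weight E \<theta>' G / product_weight E \<rho> G) =
    (\<Prod>e\<in>E. \<theta> e * (\<theta>' e / \<rho> e) + (1 - \<theta> e) * ((1 - \<theta>' e) / (1 - \<rho> e)))"
proof -
  have "product_weight E \<theta> G * product_weight E \<theta>' G / product_weight E \<rho> G =
      product_weight E \<theta> G *
      (\<Prod>e\<in>E. if e \<in> G then \<theta>' e / \<rho> e else (1 - \<theta>' e) / (1 - \<rho> e))" for G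
    unfolding times_divide_eq_right[symmetric] product_weight_def prod_dividef[symmetric]
    by (intro arg_cong2[of _ _ _ _ "(*)"] refl prod.cong) auto
  then show ?thesis
    using sum_product_weight_prod[OF assms, of \<theta> "\<lambda>e b. if b then \<theta>' e / \<rho> e else (1 - \<theta>' e) / (1 - \<rho> e)"]
    by simp
qed

text \<open>An edge contributes \<open>B\<close> if it is in neither matching, \<open>p / q\<close>
  if in exactly one, \<open>1 / q\<close> if in both. Factoring out \<open>B\<close> everywhere and
  \<open>p / (q * B)\<close> for each matching leaves \<open>q * B / p^2\<close> on common
  edges.\<close>

lemma planted_pair_ratio:
  assumes "finite E" "H \<subseteq> E" "H' \<subseteq> E" "0 < p" "0 < q" "q < 1"
  defines "B \<equiv> p\<^sup>2 / q + (1 - p)\<^sup>2 / (1 - q)"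
  shows "(\<Prod>e\<in>E. planted_prob p H e * (planted_prob p H' e / q) +
      (1 - planted_prob p H e) * ((1 - planted_prob p H' e) / (1 - q))) =
    B ^ card E * (p / (q * B)) ^ card H * (p / (q * B)) ^ card H' * (q * B / p\<^sup>2) ^ card (H \<inter> H')"
proof -
  have B: "0 < B" unfolding B_def using assms by (intro add_pos_nonneg) auto
  have res: "(\<Prod>e\<in>E. if e \<in> A then c else 1) = c ^ card A" if "A \<subseteq> E" for A and c :: real
    using that assms(1) by (simp add: prod.If_cases Int_absorb1)
  have "(\<Prod>e\<in>E. planted_prob p H e * (planted_prob p H' e / q) +
      (1 - planted_prob p H e) * ((1 - planted_prob p H' e) / (1 - q))) =
    (\<Prod>e\<in>E. B * (if e \<in> H then p / (q * B) else 1) * (if e \<in> H' then p / (q * B) else 1)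
      * (if e \<in> H \<inter> H' then q * B / p\<^sup>2 else 1))"
  proof (rule prod.cong[OF refl])
    fix e
    have "B = p * (p / q) + (1 - p) * ((1 - p) / (1 - q))"
      by (simp add: B_def power2_eq_square)
    then show "planted_prob p H e * (planted_prob p H' e / q) +
        (1 - planted_prob p H e) * ((1 - planted_prob p H' e) / (1 - q)) =
      B * (if e \<in> H then p / (q * B) else 1) * (if e \<in> H' then p / (q * B) else 1)
        * (if e \<in> H \<inter> H' then q * B / p\<^sup>2 else 1)"
      using B assms(4-6) by (simp add: planted_prob_def power2_eq_square)
  qed
  also have "\<dots> = B ^ card E * (p / (q * B)) ^ card H * (p / (q * B)) ^ card H'
      * (q * B / p\<^sup>2) ^ card (H \<inter> H')"
    unfolding prod.distrib res[OF assms(2)] res[OF assms(3)] res[OF le_infI1[OF assms(2)]] by simp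
  finally show ?thesis .
qed

text \<open>Squaring the mixture gives an average over pairs of matchings. Both have
  \<open>h\<close> edges, so only their overlap varies, and \<open>sum_matchings_power_le\<close>
  bounds the average over \<open>H'\<close> uniformly in \<open>H\<close>.\<close>

lemma planted_chi_square_le:
  assumes "n = 2 * h" "0 < h" "0 < p" "p \<le> 1" "0 < q" "q < 1"
  defines "B \<equiv> p\<^sup>2 / q + (1 - p)\<^sup>2 / (1 - q)"
  defines "y \<equiv> (q * B / p\<^sup>2 - 1) / 2"
  shows "(\<Sum>G\<in>graphs n. (pmf (planted_matching n p) G)\<^sup>2 / product_weight (complete_edges n) (\<lambda>_. q) G)
    \<le> B ^ card (complete_edges n) * (p / (q * B)) ^ n * (exp y * (1 + 8 * (y\<^sup>2 + y) / real h))"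
proof -
  let ?E = "complete_edges n" and ?PM = "perfect_matchings n"
  let ?N = "real (card ?PM)" and ?x = "q * B / p\<^sup>2"
  let ?w = "\<lambda>H. product_weight ?E (planted_prob p H)" and ?wq = "product_weight ?E (\<lambda>_. q)"
  define K where "K = B ^ card ?E * (p / (q * B)) ^ n"
  have PM: "?PM = matchings_on {1..n}" "finite {1..n}" "card {1..n} = 2 * h"
    using assms(1) by (auto simp: perfect_matchings_eq)
  have N: "?N > 0"
    using perfect_matchings_nonempty[of n] finite_perfect_matchings[of n] assms(1) by (simp add: card_gt_0_iff)
  have B: "0 < B" unfolding B_def using assms by (intro add_pos_nonneg) auto
  have "q * B = p\<^sup>2 + q * ((1 - p)\<^sup>2 / (1 - q))"
    using assms(5) by (simp add: B_def distrib_left)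
  also have "\<dots> \<ge> p\<^sup>2" using assms by simp
  finally have x: "1 \<le> ?x" using assms(3) by simp
  have P: "pmf (planted_matching n p) G = (\<Sum>H\<in>?PM. ?w H G) / ?N" if "G \<in> graphs n" for G
    using pmf_planted_matching[OF _ that] assms by simp
  have dbl: "c ^ n = c ^ h * c ^ h" for c :: real
    by (simp add: assms(1) mult_2 power_add)
  have pair: "(\<Sum>G\<in>graphs n. ?w H G * ?w H' G / ?wq G) = K * ?x ^ card (H \<inter> H')"
    if "H \<in> ?PM" "H' \<in> ?PM" for H H'
  proof -
    have "card H = h" "card H' = h" using that card_matching[OF PM(2,3)] PM(1) by auto
    moreover have "H \<subseteq> ?E" "H' \<subseteq> ?E" using that by (auto simp: perfect_matchings_def graphs_def)
    ultimately show ?thesis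
      using planted_pair_ratio[OF finite_complete_edges _ _ assms(3,5,6), of H n H']
      unfolding graphs_def sum_product_weight_ratio[OF finite_complete_edges] B_def[symmetric] K_def
      by (simp add: dbl mult_ac)
  qed
  have "(\<Sum>G\<in>graphs n. (pmf (planted_matching n p) G)\<^sup>2 / ?wq G) =
      (\<Sum>G\<in>graphs n. \<Sum>H\<in>?PM. \<Sum>H'\<in>?PM. ?w H G * ?w H' G / ?wq G / ?N\<^sup>2)"
  proof (rule sum.cong[OF refl])
    fix G assume "G \<in> graphs n"
    show "(pmf (planted_matching n p) G)\<^sup>2 / ?wq G =
        (\<Sum>H\<in>?PM. \<Sum>H'\<in>?PM. ?w H G * ?w H' G / ?wq G / ?N\<^sup>2)"
      unfolding P[OF \<open>G \<in> graphs n\<close>] power2_eq_square sum_product sum_divide_distrib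
      by (intro sum.cong refl) (simp add: mult_ac)
  qed
  also have "\<dots> = (\<Sum>H\<in>?PM. \<Sum>H'\<in>?PM. (\<Sum>G\<in>graphs n. ?w H G * ?w H' G / ?wq G) / ?N\<^sup>2)"
    unfolding sum_divide_distrib by (subst sum.swap, rule sum.cong[OF refl], rule sum.swap)
  also have "\<dots> = (\<Sum>H\<in>?PM. \<Sum>H'\<in>?PM. K * ?x ^ card (H \<inter> H') / ?N\<^sup>2)"
    by (intro sum.cong refl) (simp add: pair)
  also have "\<dots> = (\<Sum>H\<in>?PM. K / ?N * ((\<Sum>H'\<in>?PM. ?x ^ card (H \<inter> H')) / ?N))"
    unfolding sum_divide_distrib sum_distrib_left
    by (intro sum.cong refl) (simp add: power2_eq_square)
  also have "\<dots> \<le> (\<Sum>H\<in>?PM. K / ?N * (exp y * (1 + 8 * (y\<^sup>2 + y) / real h)))"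
  proof (intro sum_mono mult_left_mono)
    fix H assume "H \<in> ?PM"
    then show "(\<Sum>H'\<in>?PM. ?x ^ card (H \<inter> H')) / ?N \<le> exp y * (1 + 8 * (y\<^sup>2 + y) / real h)"
      using sum_matchings_power_le[OF PM(2,3) _ assms(2) x] unfolding PM(1) y_def by simp
    show "0 \<le> K / ?N" using B assms by (simp add: K_def)
  qed
  also have "\<dots> = K * (exp y * (1 + 8 * (y\<^sup>2 + y) / real h))"
    using N by simp
  finally show ?thesis by (simp add: K_def mult_ac)
qed


section \<open>Upper bound on the distance\<close>

text \<open>The summands come from the power of \<open>B\<close>, from
  \<open>(1 / (1 + u)) ^ n\<close> and from \<open>exp y\<close> in the chi-square bound. Their
  leading terms \<open>s / 2\<close>, \<open>- s\<close> and \<open>s / 2\<close> cancel, leaving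
  errors of order \<open>(s^2 + s) / n\<close>.\<close>

lemma planted_chi_square_exponent:
  fixes s :: real
  assumes "4 \<le> n" "0 \<le> s"
  shows "n * (n - 3) / 2 * (s / ((n - 1) * (n - 2))) - n * (s / (n - 1) - (s / (n - 1))\<^sup>2)
    + (1 + s / (n - 1)) * s * (n - 1) / (2 * (n - 2)) \<le> (3 * s\<^sup>2 + s) / n"
proof -
  have "n * (n - 3) / 2 * (s / ((n - 1) * (n - 2))) = s / 2 * ((n * (n - 3)) / ((n - 1) * (n - 2)))"
    by simp
  also have "\<dots> \<le> s / 2 * 1"
  proof (intro mult_left_mono)
    have "0 < (n - 1) * (n - 2)" using assms by simp
    then show "n * (n - 3) / ((n - 1) * (n - 2)) \<le> 1"
      by (simp add: pos_divide_le_eq) (simp add: algebra_simps)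
  qed (use assms in simp)
  finally have 1: "n * (n - 3) / 2 * (s / ((n - 1) * (n - 2))) \<le> s / 2" by simp
  have "s \<le> n * (s / (n - 1))"
    using assms by (simp add: field_simps)
  moreover have "n * (s / (n - 1))\<^sup>2 \<le> 2 * s\<^sup>2 / n"
  proof -
    have "n\<^sup>2 \<le> 2 * (n - 1)\<^sup>2"
    proof -
      have "0 \<le> n * (n - 4)" using assms by simp
      then show ?thesis by (simp add: power2_eq_square algebra_simps)
    qed
    then have "n\<^sup>2 * s\<^sup>2 \<le> 2 * (n - 1)\<^sup>2 * s\<^sup>2" by (intro mult_right_mono) auto
    then have "n\<^sup>2 * s\<^sup>2 / (n - 1)\<^sup>2 \<le> 2 * s\<^sup>2"
      using assms by (simp add: pos_divide_le_eq mult_ac)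
    then have "n\<^sup>2 * s\<^sup>2 / (n - 1)\<^sup>2 / n \<le> 2 * s\<^sup>2 / n"
      using assms by (intro divide_right_mono) auto
    then show ?thesis
      using assms by (simp add: power_divide power2_eq_square)
  qed
  ultimately have 2: "- (n * (s / (n - 1) - (s / (n - 1))\<^sup>2)) \<le> - s + 2 * s\<^sup>2 / n"
    by (simp add: right_diff_distrib)
  have "(1 + s / (n - 1)) * s * (n - 1) / (2 * (n - 2)) = s / 2 + (s + s\<^sup>2) / (2 * (n - 2))"
    using assms by (simp add: divide_simps) (simp add: algebra_simps power2_eq_square)
  also have "(s + s\<^sup>2) / (2 * (n - 2)) \<le> (s + s\<^sup>2) / n"
    using assms by (intro divide_left_mono mult_pos_pos) auto
  finally have 3: "(1 + s / (n - 1)) * s * (n - 1) / (2 * (n - 2)) \<le> s / 2 + (s + s\<^sup>2) / n" by simp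
  have "(3 * s\<^sup>2 + s) / n = s\<^sup>2 / n + 2 * s\<^sup>2 / n + s / n" "(s + s\<^sup>2) / n = s / n + s\<^sup>2 / n"
    by (simp_all add: add_divide_distrib)
  then show ?thesis using add_mono[OF add_mono[OF 1 2] 3] by simp
qed

text \<open>Everything is expressed through the odds \<open>s = (1 - p) / p\<close>. From
  \<open>s \<le> t * sqrt n\<close> follow \<open>s^2 / n \<le> t^2\<close> and
  \<open>s / n \<le> t\<close>, which turn all errors into functions of \<open>t\<close>.\<close>

lemma tv_dist_upper_bound:
  assumes "even n" "4 \<le> n" "0 < p" "p \<le> 1" and q: "q = p + (1 - p) / (real n - 1)"
  defines "t \<equiv> 1 / (p * sqrt (real n))"
  assumes t: "t \<le> 1"
  shows "graph_tv_dist n (planted_matching n p) (erdos_renyi n q)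
    \<le> 1 / 2 * sqrt (exp (3 * t\<^sup>2 + t) * (1 + (36 * t\<^sup>2 + 24 * t)) - 1)"
proof (cases "p = 1")
  \<comment> \<open>Here \<open>q = 1\<close>, so the chi-square quotient would divide by zero; both
    laws are the point mass at the complete graph.\<close>
  case True
  then have "q = 1" using q by simp
  have "t > 0" using assms by (simp add: t_def)
  then have "1 * 1 \<le> exp (3 * t\<^sup>2 + t) * (1 + (36 * t\<^sup>2 + 24 * t))"
    by (intro mult_mono) auto
  moreover have "planted_prob 1 H = (\<lambda>_. 1)" for H :: "nat set set"
    by (auto simp: planted_prob_def)
  then have "graph_tv_dist n (planted_matching n 1) (erdos_renyi n 1) = 0"
    using assms(1) perfect_matchings_nonempty[OF assms(1)] finite_perfect_matchings[of n]
    by (simp add: graph_tv_dist_def pmf_planted_matching pmf_erdos_renyi)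
  ultimately show ?thesis using True \<open>q = 1\<close> by simp
next
  case False
  then have p1: "p < 1" using assms by simp
  obtain h where h: "n = 2 * h" using assms(1) by (elim evenE)
  have n: "4 \<le> real n" using assms(2) by simp
  define s where "s = (1 - p) / p"
  define u where "u = s / (real n - 1)"
  have s: "0 < s" "s \<le> 1 / p" using p1 assms by (auto simp: s_def divide_right_mono)
  have t0: "0 < t" using assms by (simp add: t_def)
  have qp: "q = p * (1 + u)" using assms n by (simp add: q u_def s_def field_simps)
  have q1: "1 - q = (1 - p) * (real n - 2) / (real n - 1)"
    using n by (simp add: q field_simps)
  have q01: "0 < q" "q < 1"
  proof -
    show "0 < q" unfolding qp u_def using s n assms by (intro mult_pos_pos add_pos_nonneg) auto
    have "0 < 1 - q" unfolding q1 using p1 n by (intro divide_pos_pos mult_pos_pos) auto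
    then show "q < 1" by simp
  qed
  have st: "s \<le> t * sqrt (real n)" using s n by (simp add: t_def)
  have s2n: "s\<^sup>2 / real n \<le> t\<^sup>2"
    using power_mono[OF st, of 2] s n by (simp add: power_mult_distrib divide_le_eq)
  have sn: "s / real n \<le> t"
  proof -
    have "s \<le> t * real n"
    proof (rule order_trans[OF st mult_left_mono])
      show "sqrt (real n) \<le> real n"
        using n by (intro real_le_lsqrt) (auto simp: power2_eq_square)
    qed (use t0 in simp)
    then show ?thesis using n by (simp add: divide_le_eq)
  qed
  \<comment> \<open>The estimate \<open>u - u^2 \<le> ln (1 + u)\<close> used below requires
    \<open>u \<le> 1\<close>.\<close>
  have u: "0 \<le> u" "u \<le> 1"
  proof -
    show "0 \<le> u" using s n by (simp add: u_def)
    have "s \<le> sqrt (real n)" using st t t0 n by (meson mult_left_le_one_le order_trans less_imp_le real_sqrt_ge_zero of_nat_0_le_iff)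
    also have "sqrt (real n) \<le> real n - 1"
    proof (rule real_le_lsqrt)
      have "real n \<le> 3 * (real n - 1)" using n by simp
      also have "\<dots> \<le> (real n - 1)\<^sup>2"
        unfolding power2_eq_square using n by (intro mult_right_mono) auto
      finally show "real n \<le> (real n - 1)\<^sup>2" .
    qed (use n in auto)
    finally show "u \<le> 1" using n by (simp add: u_def)
  qed
  define B where "B = p\<^sup>2 / q + (1 - p)\<^sup>2 / (1 - q)"
  define y where "y = (q * B / p\<^sup>2 - 1) / 2"
  \<comment> \<open>The chi-square divergence \<open>(q - p)^2 / (q * (1 - q))\<close> between the
    Bernoulli laws of \<open>p\<close> and \<open>q\<close>, with the value of \<open>q\<close>
    inserted.\<close>
  define \<delta> where "\<delta> = (1 - p) / (q * ((real n - 1) * (real n - 2)))"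
  have qmp: "q - p = (1 - p) / (real n - 1)" by (simp add: q)
  have "(q - p)\<^sup>2 / (1 - q) = (1 - p) / ((real n - 1) * (real n - 2))"
    unfolding q1 qmp using p1 n by (simp add: power2_eq_square)
  moreover have "B - 1 = (q - p)\<^sup>2 / (1 - q) / q"
    unfolding B_def using q01 by (simp add: divide_simps) (simp add: algebra_simps power2_eq_square)
  ultimately have B: "B = 1 + \<delta>" by (simp add: \<delta>_def mult_ac)
  have "q * B - p\<^sup>2 = q * ((1 - p)\<^sup>2 / (1 - q))"
    unfolding B_def using q01 by (simp add: distrib_left)
  also have "(1 - p)\<^sup>2 / (1 - q) = (1 - p) * (real n - 1) / (real n - 2)"
    unfolding q1 using p1 n by (simp add: power2_eq_square)
  finally have qB: "q * B - p\<^sup>2 = q * ((1 - p) * (real n - 1) / (real n - 2))" .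
  have "y = (q * B - p\<^sup>2) / (2 * p\<^sup>2)"
    unfolding y_def using assms(3) by (simp add: diff_divide_distrib)
  also have "\<dots> = (1 + u) * s * (real n - 1) / (2 * (real n - 2))"
    unfolding qB unfolding qp s_def using assms(3)
    by (simp add: power2_eq_square mult_ac del: right_diff_distrib_numeral)
  finally have y: "y = (1 + u) * s * (real n - 1) / (2 * (real n - 2))" .
  have \<delta>0: "0 \<le> \<delta>"
    unfolding \<delta>_def using p1 q01 n by (intro divide_nonneg_nonneg mult_nonneg_nonneg) auto
  have \<delta>s: "\<delta> \<le> s / ((real n - 1) * (real n - 2))"
  proof -
    have "p \<le> q" unfolding qp using u assms(3) by simp
    then have "(1 - p) / q \<le> s"
      unfolding s_def using p1 assms(3) by (intro divide_left_mono) auto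
    then have "(1 - p) / q / ((real n - 1) * (real n - 2)) \<le> s / ((real n - 1) * (real n - 2))"
      using n by (intro divide_right_mono) auto
    then show ?thesis by (simp add: \<delta>_def)
  qed
  \<comment> \<open>Exactly \<open>n\<close> factors \<open>B\<close> cancel against
    \<open>(p / (q * B)) ^ n\<close>, leaving \<open>B ^ k\<close> and
    \<open>(1 / (1 + u)) ^ n\<close>.\<close>
  define k where "k = card (complete_edges n) - n"
  have "real n * 3 \<le> real n * (real n - 1)"
    using n by (intro mult_left_mono) auto
  then have "real n \<le> real (card (complete_edges n))"
    unfolding complete_edges_card by simp
  then have ck: "card (complete_edges n) = k + n" by (simp add: k_def)
  then have "real k = real n * (real n - 3) / 2"
    using complete_edges_card[of n] by (simp add: field_simps)
  then have "real k * \<delta> \<le> real n * (real n - 3) / 2 * (s / ((real n - 1) * (real n - 2)))"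
    using \<delta>s n by (simp only:) (intro mult_left_mono, auto)
  moreover have "B ^ k \<le> exp \<delta> ^ k"
    unfolding B using \<delta>0 by (intro power_mono exp_ge_add_one_self) auto
  ultimately have Bk: "B ^ k \<le> exp (real n * (real n - 3) / 2 * (s / ((real n - 1) * (real n - 2))))"
    unfolding exp_of_nat_mult[symmetric] by (meson exp_le_cancel_iff order_trans)
  have "exp (u - u\<^sup>2) \<le> 1 + u"
    using ln_one_plus_pos_lower_bound[OF u] u(1) by (simp add: ln_ge_iff)
  then have "1 / (1 + u) \<le> 1 / exp (u - u\<^sup>2)"
    using u(1) by (intro divide_left_mono) auto
  then have "1 / (1 + u) \<le> exp (- (u - u\<^sup>2))"
    by (simp only: exp_minus inverse_eq_divide)
  then have "(1 / (1 + u)) ^ n \<le> exp (- (u - u\<^sup>2)) ^ n"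
    using u(1) by (intro power_mono) auto
  then have un: "(1 / (1 + u)) ^ n \<le> exp (- (real n * (u - u\<^sup>2)))"
    unfolding exp_of_nat_mult[symmetric] by (simp only: mult_minus_right)
  have y0: "0 \<le> y" unfolding y using u(1) s n by (intro divide_nonneg_nonneg mult_nonneg_nonneg) auto
  have ys: "y \<le> 3 / 2 * s"
  proof -
    have "y = (1 + u) * s * ((real n - 1) / (2 * (real n - 2)))" by (simp add: y)
    also have "\<dots> \<le> 2 * s * (3 / 4)"
      using u s n by (intro mult_mono) (auto simp: divide_le_eq)
    finally show ?thesis by simp
  qed
  \<comment> \<open>Passing from \<open>h\<close> to \<open>n / 2\<close> doubles the 8; then
    \<open>y \<le> 3 / 2 * s\<close> produces 36 and 24.\<close>
  have "8 * (y\<^sup>2 + y) / real h = 16 * (y\<^sup>2 + y) / real n"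
    using h n by (simp add: divide_simps)
  also have "\<dots> \<le> 16 * ((3 / 2 * s)\<^sup>2 + 3 / 2 * s) / real n"
    using ys y0 n by (intro divide_right_mono mult_left_mono add_mono power_mono) auto
  also have "\<dots> = 36 * (s\<^sup>2 / real n) + 24 * (s / real n)"
    by (simp add: power2_eq_square add_divide_distrib)
  finally have yh: "1 + 8 * (y\<^sup>2 + y) / real h \<le> 1 + (36 * t\<^sup>2 + 24 * t)"
    using s2n sn by linarith
  let ?\<chi> = "\<Sum>G\<in>graphs n. (pmf (planted_matching n p) G)\<^sup>2 / product_weight (complete_edges n) (\<lambda>_. q) G"
  have B0: "0 < B" unfolding B using \<delta>0 by simp
  have "?\<chi> \<le> B ^ card (complete_edges n) * (p / (q * B)) ^ n * (exp y * (1 + 8 * (y\<^sup>2 + y) / real h))"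
    unfolding B_def y_def using assms h q01 by (intro planted_chi_square_le) auto
  also have "B ^ card (complete_edges n) * (p / (q * B)) ^ n = B ^ k * (B * (p / (q * B))) ^ n"
    unfolding ck power_add power_mult_distrib by simp
  also have "B * (p / (q * B)) = 1 / (1 + u)"
    unfolding qp using B0 assms(3) by simp
  also have "B ^ k * (1 / (1 + u)) ^ n * (exp y * (1 + 8 * (y\<^sup>2 + y) / real h)) \<le>
      exp (real n * (real n - 3) / 2 * (s / ((real n - 1) * (real n - 2)))) *
      exp (- (real n * (u - u\<^sup>2))) * (exp y * (1 + (36 * t\<^sup>2 + 24 * t)))"
    using Bk un yh B0 u(1) y0 by (intro mult_mono) (auto intro!: mult_nonneg_nonneg add_nonneg_nonneg)
  also have "\<dots> = exp (real n * (real n - 3) / 2 * (s / ((real n - 1) * (real n - 2))) -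
      real n * (u - u\<^sup>2) + y) * (1 + (36 * t\<^sup>2 + 24 * t))"
    by (simp add: exp_add exp_diff exp_minus field_simps)
  also have "\<dots> \<le> exp (3 * t\<^sup>2 + t) * (1 + (36 * t\<^sup>2 + 24 * t))"
  proof (intro mult_right_mono exp_mono)
    have "real n * (real n - 3) / 2 * (s / ((real n - 1) * (real n - 2))) - real n * (u - u\<^sup>2) + y
        \<le> (3 * s\<^sup>2 + s) / real n"
      unfolding y u_def using n s(1) by (intro planted_chi_square_exponent) auto
    also have "\<dots> = 3 * (s\<^sup>2 / real n) + s / real n" by (simp add: add_divide_distrib)
    also have "\<dots> \<le> 3 * t\<^sup>2 + t" using s2n sn by linarith
    finally show "real n * (real n - 3) / 2 * (s / ((real n - 1) * (real n - 2))) - real n * (u - u\<^sup>2) + y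
      \<le> 3 * t\<^sup>2 + t" .
  qed (use t0 in auto)
  finally have chi: "?\<chi> \<le> exp (3 * t\<^sup>2 + t) * (1 + (36 * t\<^sup>2 + 24 * t))" .
  have Q: "pmf (erdos_renyi n q) G = product_weight (complete_edges n) (\<lambda>_. q) G" if "G \<in> graphs n" for G
    using that q01 by (simp add: pmf_erdos_renyi)
  have "0 < product_weight (complete_edges n) (\<lambda>_. q) G" for G
    unfolding product_weight_def using q01 by (intro prod_pos) auto
  then have "graph_tv_dist n (planted_matching n p) (erdos_renyi n q)
      \<le> 1 / 2 * sqrt ((\<Sum>G\<in>graphs n. (pmf (planted_matching n p) G)\<^sup>2 / pmf (erdos_renyi n q) G) - 1)"
    unfolding graph_tv_dist_def using Q
    by (intro half_l1_dist_le_chi_square sum_pmf_erdos_renyi sum_pmf_planted_matching assms(1)) simp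
  also have "(\<Sum>G\<in>graphs n. (pmf (planted_matching n p) G)\<^sup>2 / pmf (erdos_renyi n q) G) = ?\<chi>"
    using Q by (intro sum.cong) auto
  also have "1 / 2 * sqrt (?\<chi> - 1) \<le>
      1 / 2 * sqrt (exp (3 * t\<^sup>2 + t) * (1 + (36 * t\<^sup>2 + 24 * t)) - 1)"
    using chi by (intro mult_left_mono real_sqrt_le_mono diff_right_mono) auto
  finally show ?thesis .
qed

subsection \<open>The limit\<close>

lemma eventually_even_at_top: "eventually (\<lambda>n. even n \<and> N \<le> n) even_at_top"
  unfolding even_at_top_def eventually_inf_principal
  by (rule eventually_mono[OF eventually_ge_at_top[of N]]) simp

lemma even_at_top_le: "even_at_top \<le> at_top"
  by (simp add: even_at_top_def)

theorem theorem3p1: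
  fixes p q :: "nat \<Rightarrow> real"
  assumes "\<And>n. even n \<Longrightarrow> 0 < n \<Longrightarrow> p n \<in> {0..1}"
    and "\<And>n. even n \<Longrightarrow> 0 < n \<Longrightarrow> q n = p n + (1 - p n) / (real n - 1)"
  shows "(filterlim (\<lambda>n. p n * sqrt (real n)) at_top even_at_top \<longrightarrow>
      ((\<lambda>n. graph_tv_dist n (planted_matching n (p n)) (erdos_renyi n (q n))) \<longlongrightarrow> 0) even_at_top) \<and>
    (((\<lambda>n. p n * sqrt (real n)) \<longlongrightarrow> 0) even_at_top \<longrightarrow>
      ((\<lambda>n. graph_tv_dist n (planted_matching n (p n)) (erdos_renyi n (q n))) \<longlongrightarrow> 1) even_at_top)"
proof (intro conjI impI)
  let ?tv = "\<lambda>n. graph_tv_dist n (planted_matching n (p n)) (erdos_renyi n (q n))"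
  {
    assume lim: "filterlim (\<lambda>n. p n * sqrt (real n)) at_top even_at_top"
    define t where "t n = 1 / (p n * sqrt (real n))" for n
    have t: "(t \<longlongrightarrow> 0) even_at_top"
      using tendsto_inverse_0_at_top[OF lim] by (simp add: t_def[abs_def] inverse_eq_divide)
    show "(?tv \<longlongrightarrow> 0) even_at_top"
    proof (rule tendsto_sandwich)
      show "eventually (\<lambda>n. 0 \<le> ?tv n) even_at_top"
        by (simp add: graph_tv_dist_def sum_nonneg)
      have "eventually (\<lambda>n. t n < 1) even_at_top"
        using order_tendstoD(2)[OF t] by simp
      moreover have "eventually (\<lambda>n. 0 < p n * sqrt (real n)) even_at_top"
        using lim by (simp add: filterlim_at_top_dense)
      ultimately show "eventually (\<lambda>n. ?tv n \<le>
          1 / 2 * sqrt (exp (3 * (t n)\<^sup>2 + t n) * (1 + (36 * (t n)\<^sup>2 + 24 * t n)) - 1)) even_at_top"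
        using eventually_even_at_top[of 4]
      proof eventually_elim
        case (elim n)
        then show ?case
          using assms(1,2)[of n] unfolding t_def
          by (intro tv_dist_upper_bound) (auto simp: zero_less_mult_iff)
      qed
      \<comment> \<open>The bound is continuous in \<open>t\<close>, and at \<open>t = 0\<close> the
        radicand is \<open>1 * 1 - 1\<close>.\<close>
      have "((\<lambda>n. 1 / 2 * sqrt (exp (3 * (t n)\<^sup>2 + t n) * (1 + (36 * (t n)\<^sup>2 + 24 * t n)) - 1))
          \<longlongrightarrow> 1 / 2 * sqrt (exp (3 * 0\<^sup>2 + 0) * (1 + (36 * 0\<^sup>2 + 24 * 0)) - 1)) even_at_top"
        by (intro tendsto_intros t)
      then show "((\<lambda>n. 1 / 2 * sqrt (exp (3 * (t n)\<^sup>2 + t n) * (1 + (36 * (t n)\<^sup>2 + 24 * t n)) - 1))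
          \<longlongrightarrow> 0) even_at_top"
        by simp
    qed simp
  next
    assume lim: "((\<lambda>n. p n * sqrt (real n)) \<longlongrightarrow> 0) even_at_top"
    show "(?tv \<longlongrightarrow> 1) even_at_top"
    proof (rule tendsto_sandwich)
      show "eventually (\<lambda>n. ?tv n \<le> 1) even_at_top"
        using eventually_even_at_top[of 0] by eventually_elim (simp add: tv_dist_le_1)
      have "eventually (\<lambda>n. p n * sqrt (real n) < 1 / 2) even_at_top"
        by (rule order_tendstoD(2)[OF lim]) simp
      then show "eventually (\<lambda>n. 1 - 1944 * (p n * sqrt (real n))\<^sup>2 - 15552 / real n \<le> ?tv n) even_at_top"
        using eventually_even_at_top[of 4]
      proof eventually_elim
        case (elim n)
        \<comment> \<open>As \<open>sqrt n \<ge> 1\<close>, smallness of \<open>p n * sqrt n\<close>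
          yields the condition \<open>p n \<le> 1 / 2\<close> of the lower bound.\<close>
        then have "p n * 1 \<le> p n * sqrt (real n)"
          using assms(1)[of n] by (intro mult_left_mono) auto
        then show ?case
          using elim assms(1,2)[of n] by (intro tv_dist_lower_bound) auto
      qed
      have "((\<lambda>n. 1 / real n) \<longlongrightarrow> 0) even_at_top"
        using lim_1_over_n by (rule tendsto_mono[OF even_at_top_le])
      then have "((\<lambda>n. 1 - 1944 * (p n * sqrt (real n))\<^sup>2 - 15552 * (1 / real n))
          \<longlongrightarrow> 1 - 1944 * 0\<^sup>2 - 15552 * 0) even_at_top"
        by (intro tendsto_intros lim)
      then show "((\<lambda>n. 1 - 1944 * (p n * sqrt (real n))\<^sup>2 - 15552 / real n) \<longlongrightarrow> 1) even_at_top"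
        by simp
    qed simp
  }
qed

end
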